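(* Let $(f,A)$ be an analytic cocycle (with values in $\mathbb{C}^{d\times d}$) over a compact, connected measure space $(\mathbb{X},\mu)$, and assume that $L_1(f,A)=-\infty$. Then $(f,A)$ is nilpotent. More precisely, $A_{r+1}(x)=\mathbf{0}$ for all $x\in\mathbb{X}$, where $r=\max_{x\in\mathbb{X}}\operatorname{rank}A(x)\le d-1$ is the maximal rank.
   Context: Analytic cocycle: $(f,A)$ is an analytic cocycle over a compact, connected measure space $(\mathbb{X},\mu)$ if: (A1) $\mathbb{X}$ is a compact, connected, real analytic manifold; (A2) $\mu$ is a probability measure on the Borel $\sigma$-algebra of $\mathbb{X}$ such that for any analytic chart (bi-analytic map) $\varphi:\mathcal{O}\subset\mathbb{X}\to U\subset\mathbb{R}^\ell$ the push-forward measure $\mu\circ\varphi^{-1}$ on $U$ has a continuous density with respect to Lebesgue measure on $U$; (A3) $f:\mathbb{X}\to\mathbb{X}$ and $A:\mathbb{X}\to\mathbb{C}^{d\times d}$ are real analytic. Throughout, $f$ is measure preserving: $\mu(f^{-1}(\mathcal{B}))=\mu(\mathcal{B})$ for all Borel sets $\mathcal{B}\subset\mathbb{X}$. Iterates: $A_n(x)=A(f^{n-1}(x))A(f^{n-2}(x))\cdots A(f(x))A(x)$ for $n\ge1$. Lyapunov exponents: with $\sigma_1(M)\ge\dots\ge\sigma_d(M)\ge0$ the singular values of $M\in\mathbb{C}^{d\times d}$, $L_k(f,A)=\lim_{n\to\infty}\frac1n\int_{\mathbb{X}}\ln(\sigma_k(A_n(x)))\,d\mu(x)\in[-\infty,\infty)$,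 with $\ln 0=-\infty$. Nilpotent: $(f,A)$ is nilpotent if for some finite $n$ one has $A_n(x)=\mathbf{0}$ for $\mu$-almost every $x$. *)

theory Defs
  imports
    "HOL-Analysis.Analysis"
    "HOL-Probability.Probability"
    "HOL-Computational_Algebra.Computational_Algebra"
begin

text \<open>Convergence is unconditional summation over all multi-indices \<open>\<alpha>\<close>.\<close>

definition real_analytic_at :: "(real ^ 'l \<Rightarrow> 'b::real_normed_vector) \<Rightarrow> real ^ 'l \<Rightarrow> bool" where
  "real_analytic_at g a \<longleftrightarrow>
     (\<exists>r>0. \<exists>c :: ('l \<Rightarrow> nat) \<Rightarrow> 'b. \<forall>x\<in>ball a r.
        ((\<lambda>\<alpha>. (\<Prod>i\<in>UNIV. (x $ i - a $ i) ^ \<alpha> i) *\<^sub>R c \<alpha>) has_sum g x) UNIV)"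

definition real_analytic_on :: "(real ^ 'l \<Rightarrow> 'b::real_normed_vector) \<Rightarrow> (real ^ 'l) set \<Rightarrow> bool" where
  "real_analytic_on g U \<longleftrightarrow> (\<forall>a\<in>U. real_analytic_at g a)"

text \<open>A chart is a pair of its domain and a coordinate map, whose values outside the domain are
  irrelevant.\<close>

type_synonym ('x, 'l) chart = "'x set \<times> ('x \<Rightarrow> real ^ 'l)"

definition topological_chart :: "('x::topological_space, 'l::finite) chart \<Rightarrow> bool" where
  "topological_chart = (\<lambda>(S, \<phi>). open S \<and> open (\<phi> ` S) \<and> (\<exists>\<psi>. homeomorphism S (\<phi> ` S) \<phi> \<psi>))"

definition analytic_transition :: "('x, 'l::finite) chart \<Rightarrow> ('x, 'l) chart \<Rightarrow> bool" where
  "analytic_transition = (\<lambda>(S, \<phi>) (T, \<psi>). real_analytic_on (\<psi> \<circ> inv_into S \<phi>) (\<phi> ` (S \<inter> T)))"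

text \<open>The type \<open>real ^ 'l\<close> has positive dimension. The second disjunct covers manifolds of
  dimension 0, which are the discrete spaces: they are represented by the empty atlas. All
  conditions below that are stated in charts are then vacuous, as they should be.\<close>

definition real_analytic_atlas :: "('x::topological_space, 'l::finite) chart set \<Rightarrow> bool" where
  "real_analytic_atlas \<A> \<longleftrightarrow>
     ((\<Union>(S, \<phi>)\<in>\<A>. S) = UNIV \<and> (\<forall>c\<in>\<A>. topological_chart c) \<and>
      (\<forall>c\<in>\<A>. \<forall>c'\<in>\<A>. analytic_transition c c'))
   \<or> (\<A> = {} \<and> (\<forall>x::'x. open {x}))"

text \<open>The charts of the maximal atlas, i.e. the bi-analytic maps between open sets.\<close>

definition analytic_chart ::
  "('x::topological_space, 'l::finite) chart set \<Rightarrow> ('x, 'l) chart \<Rightarrow> bool" where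
  "analytic_chart \<A> c \<longleftrightarrow> topological_chart c \<and>
     (\<forall>c'\<in>\<A>. analytic_transition c c' \<and> analytic_transition c' c)"

definition analytic_self_map ::
  "('x::topological_space, 'l::finite) chart set \<Rightarrow> ('x \<Rightarrow> 'x) \<Rightarrow> bool" where
  "analytic_self_map \<A> f \<longleftrightarrow> continuous_on UNIV f \<and>
     (\<forall>(S, \<phi>)\<in>\<A>. \<forall>(T, \<psi>)\<in>\<A>.
        real_analytic_on (\<psi> \<circ> f \<circ> inv_into S \<phi>) (\<phi> ` (S \<inter> f -` T)))"

definition analytic_vector_map ::
  "('x, 'l::finite) chart set \<Rightarrow> ('x \<Rightarrow> 'b::real_normed_vector) \<Rightarrow> bool" where
  "analytic_vector_map \<A> g \<longleftrightarrow>
     (\<forall>(S, \<phi>)\<in>\<A>. real_analytic_on (g \<circ> inv_into S \<phi>) (\<phi> ` S))"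

definition continuous_density_in_charts ::
  "('x::topological_space, 'l::finite) chart set \<Rightarrow> 'x measure \<Rightarrow> bool" where
  "continuous_density_in_charts \<A> \<mu> \<longleftrightarrow>
     (\<forall>S \<phi>. analytic_chart \<A> (S, \<phi>) \<longrightarrow>
        (\<exists>\<rho>. continuous_on (\<phi> ` S) \<rho> \<and> (\<forall>y\<in>\<phi> ` S. 0 \<le> \<rho> y) \<and>
           distr (restrict_space \<mu> S) (restrict_space borel (\<phi> ` S)) \<phi>
             = density (restrict_space lborel (\<phi> ` S)) (\<lambda>y. ennreal (\<rho> y))))"

definition analytic_cocycle ::
  "('x::{t2_space, second_countable_topology}, 'l::finite) chart set \<Rightarrow> 'x measure \<Rightarrow>
   ('x \<Rightarrow> 'x) \<Rightarrow> ('x \<Rightarrow> complex ^ 'd ^ 'd) \<Rightarrow> bool" where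
  "analytic_cocycle \<A> \<mu> f A \<longleftrightarrow>
     compact (UNIV :: 'x set) \<and> connected (UNIV :: 'x set) \<and> real_analytic_atlas \<A> \<and>
     prob_space \<mu> \<and> sets \<mu> = sets borel \<and> continuous_density_in_charts \<A> \<mu> \<and>
     analytic_self_map \<A> f \<and> analytic_vector_map \<A> A"

definition measure_preserving :: "'x measure \<Rightarrow> ('x \<Rightarrow> 'x) \<Rightarrow> bool" where
  "measure_preserving \<mu> f \<longleftrightarrow> f \<in> measurable \<mu> \<mu> \<and>
     (\<forall>B\<in>sets \<mu>. emeasure \<mu> (f -` B \<inter> space \<mu>) = emeasure \<mu> B)"

primrec cocycle_iter ::
  "('x \<Rightarrow> 'x) \<Rightarrow> ('x \<Rightarrow> complex ^ 'd ^ 'd) \<Rightarrow> nat \<Rightarrow> 'x \<Rightarrow> complex ^ 'd ^ 'd" where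
  "cocycle_iter f A 0 x = mat 1"
| "cocycle_iter f A (Suc n) x = A ((f ^^ n) x) ** cocycle_iter f A n x"

definition nilpotent_cocycle ::
  "'x measure \<Rightarrow> ('x \<Rightarrow> 'x) \<Rightarrow> ('x \<Rightarrow> complex ^ 'd ^ 'd) \<Rightarrow> bool" where
  "nilpotent_cocycle \<mu> f A \<longleftrightarrow> (\<exists>n\<ge>1. AE x in \<mu>. cocycle_iter f A n x = 0)"

definition conj_transpose :: "complex ^ 'n ^ 'm \<Rightarrow> complex ^ 'm ^ 'n" where
  "conj_transpose M = transpose (map_matrix cnj M)"

definition charpoly :: "complex ^ 'd ^ 'd \<Rightarrow> complex poly" where
  "charpoly M = det (mat [:0, 1:] - map_matrix (\<lambda>z. [:z:]) M)"

text \<open>The square roots of the eigenvalues of \<open>M\<^sup>* M\<close>, with multiplicity, in decreasing order. These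
  eigenvalues are real and nonnegative, so taking real parts loses nothing.\<close>

definition singular_values :: "complex ^ 'd ^ 'd \<Rightarrow> real list" where
  "singular_values M =
     rev (sorted_list_of_multiset
       (image_mset (\<lambda>z. sqrt (Re z)) (proots (charpoly (conj_transpose M ** M)))))"

definition singular_value :: "nat \<Rightarrow> complex ^ 'd ^ 'd \<Rightarrow> real" where
  "singular_value k M = singular_values M ! (k - 1)"

definition ext_ln :: "real \<Rightarrow> ereal" where
  "ext_ln t = (if t = 0 then -\<infinity> else ereal (ln t))"

text \<open>The integral of an extended real function as the integral of its positive part minus that of
  its negative part. It is used only for functions that are bounded above on a probability space,
  so the first of the two is finite.\<close>

definition ext_integral :: "'x measure \<Rightarrow> ('x \<Rightarrow> ereal) \<Rightarrow> ereal" where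
  "ext_integral M h =
     enn2ereal (\<integral>\<^sup>+ x. e2ennreal (max 0 (h x)) \<partial>M) - enn2ereal (\<integral>\<^sup>+ x. e2ennreal (max 0 (- h x)) \<partial>M)"

definition lyapunov_exponent ::
  "'x measure \<Rightarrow> ('x \<Rightarrow> 'x) \<Rightarrow> ('x \<Rightarrow> complex ^ 'd ^ 'd) \<Rightarrow> nat \<Rightarrow> ereal" where
  "lyapunov_exponent \<mu> f A k =
     lim (\<lambda>n. ext_integral \<mu> (\<lambda>x. ext_ln (singular_value k (cocycle_iter f A n x))) / ereal (real n))"

definition max_rank :: "('x \<Rightarrow> complex ^ 'd ^ 'd) \<Rightarrow> nat" where
  "max_rank A = Max (range (\<lambda>x. rank (A x)))"

end

theory Submission
  imports Defs "HOL-Complex_Analysis.Complex_Analysis"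
begin

text \<open>
  The maximal ranks \<open>r\<^sub>n\<close> of the iterates, taken over all base points, decrease with \<open>n\<close>, starting
  from the full dimension at \<open>n = 0\<close> and with \<open>r\<^sub>1 = r\<close>. If they decrease strictly as long as they are
  positive, then \<open>r < d\<close> and \<open>r\<^sub>n \<le> r + 1 - n\<close> for positive \<open>n\<close>, so the iterate of order \<open>r + 1\<close>
  vanishes everywhere. It remains to show that two equal consecutive ranks
  \<open>r\<^sub>k = r\<^sub>k\<^sub>+\<^sub>1 > 0\<close> exclude the exponent \<open>-\<infinity>\<close>; this is
  \<open>lyapunov_exponent_finite_if_rank_stabilizes\<close>.

  Equal ranks mean that, for generic \<open>x\<close>, the factor \<open>A (f\<^sup>k x)\<close> is injective on the range of
  the \<open>k\<close>-th iterate. The lemma \<open>norm_ge_det_mult_norm\<close> makes this quantitative: on that range the factor multiplies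
  norms by at least \<open>c \<bar>m x\<bar>\<close> with a constant \<open>c > 0\<close>, where \<open>m\<close> is a determinant in the entries of the
  next iterate that does not vanish identically. Since ranges of later iterates are contained in ranges of
  \<open>k\<close>-th iterates, the bounds multiply along the orbit, and the logarithm of the norm of the \<open>n\<close>-th
  iterate is at least a Birkhoff sum of \<open>ln \<bar>c m\<bar>\<close> plus the logarithm of a fixed function. By
  invariance of the measure, the exponent is not \<open>-\<infinity>\<close> once \<open>ln \<bar>m\<bar>\<close> is integrable.

  Integrability of \<open>ln \<bar>h\<bar>\<close> for an analytic function \<open>h\<close> that is not identically zero is
  \<open>analytic_function_log_integrable\<close>. By the identity theorem, \<open>h\<close> has at every point a nonzero
  directional derivative of some order \<open>k\<close>, which persists nearby. By an estimate of van der Corput type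
  (\<open>sublevel_interval_cover\<close>) the set where \<open>\<bar>h\<bar> < c \<eta>\<^sup>k\<close> has measure \<open>O(\<eta>)\<close>,
  first on line segments and then, by averaging over translates, in coordinates. Summation over dyadic
  levels gives the integral.

  Analyticity is carried through products, determinants and composition with \<open>f\<close> in the form of
  holomorphic extensions that are tested on complex curves. The first singular value is identified with the operator
  norm by \<open>singular_value_1\<close>, so that the integrated logarithms are subadditive and Fekete's lemma
  gives existence of the limit that defines the exponent.
\<close>

text \<open>The symbol denotes components of vectors only, not coefficients of power series.\<close>

no_notation fps_nth (infixl "$" 75)

section \<open>Ranks and generalized inverses\<close>

text \<open>The rank is defined as the row rank. Expanding the rows of a matrix in a basis of the row space
  factors the matrix through that basis, so the column space is spanned by as many vectors as the
  basis has. Applied to the matrix and to its transpose, this gives equality over any field.\<close>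

lemma rank_eq_dim_range:
  fixes M :: "'a::field^'n^'m"
  shows "rank M = vec.dim (range ((*v) M))"
proof -
  have le: "vec.dim (range ((*v) B)) \<le> vec.dim (rows B)" for B :: "'a^'p^'q"
  proof -
    obtain b where b: "b \<subseteq> rows B" "vec.independent b" "rows B \<subseteq> vec.span b"
        "card b = vec.dim (rows B)"
      using vec.basis_exists by blast
    have fin: "finite b"
      using b(2) vec.finiteI_independent by blast
    have "\<exists>c. row i B = (\<Sum>w\<in>b. c w *s w)" for i
      using b(3) vec.span_finite[OF fin] by (auto simp: rows_def)
    then obtain c where c: "\<And>i. row i B = (\<Sum>w\<in>b. c i w *s w)"
      by metis
    have "B *v v \<in> vec.span ((\<lambda>w. \<chi> i. c i w) ` b)" for v
    proof -
      have "B *v v = (\<Sum>w\<in>b. (\<Sum>j\<in>UNIV. w $ j * v $ j) *s (\<chi> i. c i w))"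
      proof (rule vec_eq_iff[THEN iffD2], rule)
        fix i
        have "(B *v v) $ i = (\<Sum>j\<in>UNIV. row i B $ j * v $ j)"
          by (simp add: matrix_vector_mult_def row_def)
        also have "\<dots> = (\<Sum>j\<in>UNIV. \<Sum>w\<in>b. c i w * w $ j * v $ j)"
          by (simp add: c sum_distrib_right)
        also have "\<dots> = (\<Sum>w\<in>b. \<Sum>j\<in>UNIV. c i w * w $ j * v $ j)"
          by (rule sum.swap)
        finally show "(B *v v) $ i = (\<Sum>w\<in>b. (\<Sum>j\<in>UNIV. w $ j * v $ j) *s (\<chi> i. c i w)) $ i"
          by (simp add: sum_distrib_left sum_distrib_right mult_ac)
      qed
      also have "\<dots> \<in> vec.span ((\<lambda>w. \<chi> i. c i w) ` b)"
        by (intro vec.span_sum vec.span_scale vec.span_base) auto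
      finally show ?thesis .
    qed
    then have "vec.dim (range ((*v) B)) \<le> card ((\<lambda>w. \<chi> i. c i w) ` b)"
      by (intro vec.dim_le_card) (use fin in auto)
    also have "\<dots> \<le> card b"
      by (rule card_image_le[OF fin])
    finally show ?thesis
      using b(4) by simp
  qed
  have col: "columns B \<subseteq> range ((*v) B)" for B :: "'a^'p^'q"
  proof -
    have "column j B = B *v axis j 1" for j
      by (simp add: vec_eq_iff column_def matrix_vector_mult_def axis_def if_distrib cong: if_cong)
    then show ?thesis
      by (auto simp: columns_def)
  qed
  have "vec.dim (rows M) \<le> vec.dim (range ((*v) (transpose M)))"
    using col[of "transpose M"] by (simp add: vec.dim_subset)
  also have "\<dots> \<le> vec.dim (columns M)"
    using le[of "transpose M"] by simp
  also have "\<dots> \<le> vec.dim (range ((*v) M))"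
    by (rule vec.dim_subset[OF col])
  finally show ?thesis
    using le[of M] by (simp add: row_rank_def_gen)
qed

lemma rank_mult_le_right:
  fixes M :: "'a::field^'n^'m" and B :: "'a^'p^'n"
  shows "rank (M ** B) \<le> rank B"
proof -
  have "range ((*v) (M ** B)) = (*v) M ` range ((*v) B)"
    by (auto simp: image_image matrix_vector_mul_assoc)
  then show ?thesis
    by (simp add: rank_eq_dim_range vec.dim_image_le)
qed

lemma rank_mult_le_left:
  fixes M :: "'a::field^'n^'m" and B :: "'a^'p^'n"
  shows "rank (M ** B) \<le> rank M"
  unfolding rank_eq_dim_range
  by (rule vec.dim_subset) (auto simp: matrix_vector_mul_assoc[symmetric])

lemma rank_le_CARD:
  fixes M :: "'a::field^'n^'n"
  shows "rank M \<le> CARD('n)"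
  unfolding rank_eq_dim_range vec_dim_card[where 'a='a and 'n='n, symmetric] by (rule vec.dim_subset) simp

lemma rank_mat_1: "rank (mat 1 :: 'a::field^'n^'n) = CARD('n)"
  unfolding rank_eq_dim_range using vec_dim_card[where 'a='a and 'n='n] by (simp del: vec.dim_UNIV)

lemma rank_pos:
  fixes M :: "'a::field^'n^'m"
  shows "0 < rank M \<longleftrightarrow> M \<noteq> 0"
proof -
  have "rank M = 0 \<longleftrightarrow> (\<forall>v. M *v v = 0)"
    unfolding rank_eq_dim_range by (auto simp: vec.dim_eq_0)
  also have "\<dots> \<longleftrightarrow> M = 0"
    by (auto simp: matrix_eq)
  finally show ?thesis
    by (metis bot_nat_0.not_eq_extremum)
qed

text \<open>Such an \<open>E\<close> makes \<open>E ** Q\<close> a projection with the rank of \<open>Q\<close>. It plays the role of a choice of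
  a nonvanishing minor of \<open>Q\<close>, without reference to rows and columns.\<close>

lemma reflexive_generalized_inverse:
  fixes Q :: "'a::field^'n^'m"
  obtains E :: "'a^'m^'n" where "Q ** E ** Q = Q" "E ** Q ** E = E"
proof -
  obtain g where g: "Vector_Spaces.linear (*s) (*s) g" "\<And>w. w \<in> range ((*v) Q) \<Longrightarrow> Q *v g w = w"
    using vec.linear_exists_right_inverse_on[OF matrix_vector_mul_linear_gen vec.subspace_UNIV, of Q] by blast
  define E0 where "E0 = matrix g"
  have E0: "E0 *v w = g w" for w
    unfolding E0_def by (rule matrix_works[OF g(1)])
  have *: "Q ** E0 ** Q = Q"
    unfolding matrix_eq by (simp add: matrix_vector_mul_assoc[symmetric] E0 g(2))
  \<comment> \<open>Any right inverse on the range gives the first identity; placing \<open>Q\<close> between two copies of it gives both.\<close>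
  show thesis
  proof (rule that[of "E0 ** Q ** E0"])
    show "Q ** (E0 ** Q ** E0) ** Q = Q"
      by (metis "*" matrix_mul_assoc)
    show "E0 ** Q ** E0 ** Q ** (E0 ** Q ** E0) = E0 ** Q ** E0"
      by (metis "*" matrix_mul_assoc)
  qed
qed

text \<open>A linear map that carries the range of \<open>P\<close> onto a space of at least the same dimension is
  injective on that range.\<close>

lemma ker_of_mult_of_equal_rank:
  fixes B :: "'a::field^'n^'m" and P :: "'a^'p^'n"
  assumes "rank P \<le> rank (B ** P)" and "(B ** P) *v z = 0"
  shows "P *v z = 0"
proof -
  let ?V = "range ((*v) P)"
  have V: "vec.subspace ?V"
    by (simp add: vec.linear_subspace_image)
  obtain g where g: "g ` UNIV \<subseteq> ?V" "Vector_Spaces.linear (*s) (*s) g"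
      "\<And>w. w \<in> (*v) B ` ?V \<Longrightarrow> B *v g w = w"
    using vec.linear_exists_right_inverse_on[OF matrix_vector_mul_linear_gen V, of B] by blast
  let ?W = "(*v) B ` ?V"
  have W: "?W = range ((*v) (B ** P))"
    by (auto simp: image_image matrix_vector_mul_assoc)
  have sub: "vec.subspace (g ` ?W)" 
    by (intro vec.linear_subspace_image g V) auto
  have "?W = (*v) B ` g ` ?W"
    using g(3) by (auto simp: image_image cong: image_cong)
  then have "vec.dim ?W \<le> vec.dim (g ` ?W)"
    by (metis vec.dim_image_le matrix_vector_mul_linear_gen)
  then have "vec.dim ?V \<le> vec.dim (g ` ?W)"
    using assms(1) by (simp add: rank_eq_dim_range W)
  then have "g ` ?W = ?V"
    using g(1) by (intro vec.subspace_dim_equal[OF sub V]) auto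
  then obtain w where w: "w \<in> ?W" "P *v z = g w"
    by blast
  then have "w = (B ** P) *v z"
    using g(3) by (metis matrix_vector_mul_assoc)
  then show ?thesis
    using w(2) assms(2) g(2) vec.linear_0 by metis
qed

lemma matrix_mult_diff_ldistrib:
  fixes M :: "'a::ring_1^'n^'m"
  shows "M ** (B - C) = M ** B - M ** C"
  by (simp add: matrix_matrix_mult_def vec_eq_iff sum_subtractf algebra_simps)

text \<open>The determinant plays the role of a minor of \<open>B ** P\<close> of size \<open>rank Q0\<close>: it equals 1 for
  \<open>B ** P = Q0\<close>, and where it does not vanish, \<open>B ** P\<close> has rank at least \<open>rank Q0\<close>. Since \<open>P\<close> has
  no larger rank, \<open>B\<close> is then injective on the range of \<open>P\<close>, and \<open>P *v v\<close> is determined by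
  \<open>(B ** P) *v v\<close> through the linear system for \<open>y\<close>.\<close>

lemma solve_through_smaller_vector:
  fixes E Q0 B P :: "'a::field^'n^'n"
  assumes "E ** Q0 ** E = E" "Q0 ** E ** Q0 = Q0" and rk: "rank P \<le> rank Q0"
    and inv: "det (E ** (B ** P) + (mat 1 - E ** Q0)) \<noteq> 0"
    and y: "(E ** (B ** P) + (mat 1 - E ** Q0)) *v y = E *v ((B ** P) *v v)"
  shows "P *v v = P *v y"
proof -
  define T where "T = E ** (B ** P) + (mat 1 - E ** Q0)"
  \<comment> \<open>The projection \<open>E ** Q0\<close> annihilates the summand \<open>mat 1 - E ** Q0\<close> of \<open>T\<close>.\<close>
  have "E ** Q0 ** T = E ** Q0 ** E ** (B ** P) + (E ** Q0 - E ** Q0 ** E ** Q0)"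
    unfolding T_def by (simp add: matrix_add_ldistrib matrix_mult_diff_ldistrib matrix_mul_assoc)
  then have ET: "E ** Q0 ** T = (E ** B) ** P"
    using assms(1) by (simp add: matrix_mul_assoc)
  have "invertible T"
    using inv by (simp add: T_def invertible_det_nz)
  then obtain T' where T': "T ** T' = mat 1"
    by (auto simp: invertible_def)
  have "(E ** B) ** P ** T' = E ** Q0"
    by (metis ET T' matrix_mul_assoc matrix_mul_rid)
  then have "rank (E ** Q0) \<le> rank ((E ** B) ** P)"
    by (metis rank_mult_le_left)
  moreover have "rank Q0 \<le> rank (E ** Q0)"
    by (metis assms(2) matrix_mul_assoc rank_mult_le_right)
  ultimately have "rank P \<le> rank ((E ** B) ** P)"
    using rk by simp
  moreover have "((E ** B) ** P) *v (v - y) = 0"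
  proof -
    have "((E ** B) ** P) *v y = (E ** Q0) *v (E *v ((B ** P) *v v))"
      using y by (simp add: ET[symmetric] matrix_vector_mul_assoc[symmetric] T_def[symmetric])
    also have "\<dots> = ((E ** B) ** P) *v v"
      using assms(1) by (simp add: matrix_vector_mul_assoc matrix_mul_assoc)
    finally show ?thesis
      by (simp add: matrix_vector_mult_diff_distrib)
  qed
  ultimately have "P *v (v - y) = 0"
    by (rule ker_of_mult_of_equal_rank)
  then show ?thesis
    by (simp add: matrix_vector_mult_diff_distrib)
qed

section \<open>Operator norms and contraction on a range\<close>

abbreviation opnorm :: "complex ^ 'n ^ 'm \<Rightarrow> real" where
  "opnorm M \<equiv> onorm ((*v) M)"

lemma opnorm_bound: "norm (M *v v) \<le> opnorm M * norm v"
  by (rule onorm) simp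

lemma opnorm_nonneg: "0 \<le> opnorm M"
  by (rule onorm_pos_le) simp

lemma opnorm_mult_le: "opnorm (M ** B) \<le> opnorm M * opnorm B"
proof -
  have "(*v) (M ** B) = (*v) M \<circ> (*v) B"
    by (simp add: fun_eq_iff matrix_vector_mul_assoc)
  then show ?thesis
    using onorm_compose[of "(*v) M" "(*v) B"] by simp
qed

lemma opnorm_le_sum_entries: "opnorm M \<le> (\<Sum>i\<in>UNIV. \<Sum>j\<in>UNIV. cmod (M $ i $ j))"
proof (rule onorm_le)
  fix v
  have "norm (M *v v) \<le> (\<Sum>i\<in>UNIV. cmod ((M *v v) $ i))"
    unfolding norm_vec_def by (intro L2_set_le_sum) auto
  also have "\<dots> \<le> (\<Sum>i\<in>UNIV. \<Sum>j\<in>UNIV. cmod (M $ i $ j) * norm v)"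
  proof (rule sum_mono)
    fix i
    have "cmod ((M *v v) $ i) \<le> (\<Sum>j\<in>UNIV. cmod (M $ i $ j * v $ j))"
      unfolding matrix_vector_mult_def by (simp add: norm_sum)
    also have "\<dots> \<le> (\<Sum>j\<in>UNIV. cmod (M $ i $ j) * norm v)"
      by (intro sum_mono) (simp add: norm_mult mult_left_mono Finite_Cartesian_Product.norm_nth_le)
    finally show "cmod ((M *v v) $ i) \<le> (\<Sum>j\<in>UNIV. cmod (M $ i $ j) * norm v)" .
  qed
  finally show "norm (M *v v) \<le> (\<Sum>i\<in>UNIV. \<Sum>j\<in>UNIV. cmod (M $ i $ j)) * norm v"
    by (simp add: sum_distrib_right)
qed

lemma abs_opnorm_diff_le: "\<bar>opnorm M - opnorm B\<bar> \<le> opnorm (M - B)"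
proof -
  have *: "opnorm P \<le> opnorm R + opnorm (P - R)" for P R :: "complex^'a^'b"
    using onorm_triangle[of "(*v) R" "(*v) (P - R)"]
    by (simp add: matrix_vector_mult_add_rdistrib[symmetric])
  have "(*v) (B - M) = (\<lambda>v. - ((M - B) *v v))"
    by (simp add: fun_eq_iff matrix_vector_mult_diff_rdistrib)
  then have "opnorm (B - M) = opnorm (M - B)"
    by (simp only: onorm_neg)
  then show ?thesis
    using *[of M B] *[of B M] by simp
qed

lemma continuous_on_opnorm:
  fixes F :: "'x::topological_space \<Rightarrow> complex ^ 'n ^ 'm"
  assumes "\<And>i j. continuous_on S (\<lambda>x. F x $ i $ j)"
  shows "continuous_on S (\<lambda>x. opnorm (F x))"
  unfolding continuous_on_def
proof
  fix x assume x: "x \<in> S"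
  have "((\<lambda>y. \<Sum>i\<in>UNIV. \<Sum>j\<in>UNIV. cmod ((F y - F x) $ i $ j)) \<longlongrightarrow>
      (\<Sum>i\<in>UNIV. \<Sum>j\<in>UNIV. cmod ((F x - F x) $ i $ j))) (at x within S)"
    unfolding vector_minus_component
    by (intro tendsto_sum tendsto_norm tendsto_diff tendsto_const)
       (use assms x in \<open>auto simp: continuous_on_def\<close>)
  then have "((\<lambda>y. \<Sum>i\<in>UNIV. \<Sum>j\<in>UNIV. cmod ((F y - F x) $ i $ j)) \<longlongrightarrow> 0) (at x within S)"
    by simp
  then have "((\<lambda>y. opnorm (F y) - opnorm (F x)) \<longlongrightarrow> 0) (at x within S)"
  proof (rule Lim_null_comparison[rotated], intro always_eventually allI)
    show "norm (opnorm (F y) - opnorm (F x)) \<le> (\<Sum>i\<in>UNIV. \<Sum>j\<in>UNIV. cmod ((F y - F x) $ i $ j))" for y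
      unfolding real_norm_def by (rule order_trans[OF abs_opnorm_diff_le opnorm_le_sum_entries])
  qed
  then show "((\<lambda>y. opnorm (F y)) \<longlongrightarrow> opnorm (F x)) (at x within S)"
    by (rule LIM_zero_cancel)
qed

text \<open>By Cramer's rule each coordinate of \<open>y\<close> times \<open>det T\<close> is a determinant with \<open>T *v y\<close> in one column;
  every product in its expansion contains exactly one factor from that column.\<close>

lemma cmod_det_mult_norm_le:
  fixes K :: real
  obtains C where "C > 0"
    "\<And>(T :: complex ^ 'n ^ 'n) y. (\<And>i j. cmod (T $ i $ j) \<le> K) \<Longrightarrow> cmod (det T) * norm y \<le> C * norm (T *v y)"
proof -
  define K' where "K' = max K 1"
  define C where "C = CARD('n) * (fact CARD('n) * K' ^ CARD('n) :: real)"
  have K': "K' \<ge> 1" "K \<le> K'" by (auto simp: K'_def)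
  have "C > 0"
    unfolding C_def using K' by (intro mult_pos_pos) auto
  moreover have "cmod (det T) * norm y \<le> C * norm (T *v y)"
    if T: "\<And>i j. cmod (T $ i $ j) \<le> K" for T :: "complex ^ 'n ^ 'n" and y
  proof -
    let ?b = "T *v y"
    let ?S = "{p. p permutes (UNIV::'n set)}"
    have comp: "cmod (det T) * cmod (y $ k) \<le> fact CARD('n) * K' ^ CARD('n) * norm ?b" for k
    proof -
      let ?M = "(\<chi> i j. if j = k then ?b $ i else T $ i $ j) :: complex^'n^'n"
      have summand: "(\<Prod>i\<in>UNIV. cmod (?M $ i $ p i)) \<le> K' ^ CARD('n) * norm ?b" if p: "p permutes UNIV" for p
      proof -
        define i0 where "i0 = inv p k"
        have i0: "p i0 = k"
          unfolding i0_def using permutes_inverses(1)[OF p] .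
        have ne: "p i \<noteq> k" if "i \<noteq> i0" for i
          using that i0 permutes_inj[OF p] by (auto dest: injD)
        have "(\<Prod>i\<in>UNIV. cmod (?M $ i $ p i)) = cmod (?M $ i0 $ p i0) * (\<Prod>i\<in>UNIV - {i0}. cmod (?M $ i $ p i))"
          by (rule prod.remove) auto
        also have "\<dots> \<le> norm ?b * (\<Prod>i\<in>UNIV - {i0}. K')"
        proof (rule mult_mono)
          show "cmod (?M $ i0 $ p i0) \<le> norm ?b"
            by (simp add: i0 Finite_Cartesian_Product.norm_nth_le)
          show "(\<Prod>i\<in>UNIV - {i0}. cmod (?M $ i $ p i)) \<le> (\<Prod>i\<in>UNIV - {i0}. K')"
            by (rule prod_mono) (use ne T K' order_trans in \<open>auto, blast\<close>)
        qed (auto intro: prod_nonneg)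
        also have "\<dots> \<le> norm ?b * K' ^ CARD('n)"
          using K' by (intro mult_left_mono) (auto intro: power_increasing)
        finally show ?thesis by (simp add: mult.commute)
      qed
      have "cmod (det ?M) \<le> (\<Sum>p\<in>?S. cmod (of_int (sign p) * (\<Prod>i\<in>UNIV. ?M $ i $ p i)))"
        unfolding det_def by (rule norm_sum)
      also have "\<dots> = (\<Sum>p\<in>?S. \<Prod>i\<in>UNIV. cmod (?M $ i $ p i))"
        by (intro sum.cong refl) (auto simp: norm_mult prod_norm sign_def)
      also have "\<dots> \<le> (\<Sum>p\<in>?S. K' ^ CARD('n) * norm ?b)"
        by (intro sum_mono summand) auto
      also have "\<dots> = fact CARD('n) * K' ^ CARD('n) * norm ?b"
        using card_permutations[of "UNIV::'n set" "CARD('n)"] by simp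
      finally have "cmod (det ?M) \<le> fact CARD('n) * K' ^ CARD('n) * norm ?b" .
      then show ?thesis
        unfolding cramer_lemma by (simp add: norm_mult mult.commute)
    qed
    have "cmod (det T) * norm y \<le> cmod (det T) * (\<Sum>k\<in>UNIV. cmod (y $ k))"
      unfolding norm_vec_def by (intro mult_left_mono L2_set_le_sum) auto
    also have "\<dots> \<le> (\<Sum>k\<in>(UNIV::'n set). fact CARD('n) * K' ^ CARD('n) * norm ?b)"
      unfolding sum_distrib_left by (intro sum_mono comp)
    finally show ?thesis
      by (simp add: C_def mult_ac)
  qed
  ultimately show thesis
    using that by blast
qed

text \<open>The quantitative form of the injectivity in \<open>solve_through_smaller_vector\<close>: on the range of \<open>P\<close>, multiplication by \<open>B\<close>
  scales norms by at least a multiple of the determinant. The constant depends only on \<open>E\<close> and on the bound \<open>K\<close>, so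
  it is uniform over a compact family of matrices.\<close>

lemma norm_ge_det_mult_norm:
  fixes E Q0 :: "complex ^ 'n ^ 'n"
  assumes "E ** Q0 ** E = E" "Q0 ** E ** Q0 = Q0"
  obtains c where "c > 0"
    "\<And>(B :: complex ^ 'n ^ 'n) P v. rank P \<le> rank Q0 \<Longrightarrow> opnorm P \<le> K \<Longrightarrow>
       (\<forall>i j. cmod ((E ** (B ** P) + (mat 1 - E ** Q0)) $ i $ j) \<le> K) \<Longrightarrow>
       c * cmod (det (E ** (B ** P) + (mat 1 - E ** Q0))) * norm (P *v v) \<le> norm ((B ** P) *v v)"
proof -
  obtain C where C: "C > 0"
    "\<And>(T :: complex ^ 'n ^ 'n) y. (\<And>i j. cmod (T $ i $ j) \<le> K) \<Longrightarrow> cmod (det T) * norm y \<le> C * norm (T *v y)"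
    using cmod_det_mult_norm_le by blast
  define K' where "K' = max K 1"
  define L where "L = K' * C * (opnorm E + 1)"
  have L: "L > 0"
    unfolding L_def K'_def using C(1) opnorm_nonneg[of E] by (intro mult_pos_pos) auto
  show thesis
  proof (rule that[of "1 / L"])
    fix B P :: "complex^'n^'n" and v
    assume rk: "rank P \<le> rank Q0" and P: "opnorm P \<le> K"
    define T where "T = E ** (B ** P) + (mat 1 - E ** Q0)"
    assume "\<forall>i j. cmod ((E ** (B ** P) + (mat 1 - E ** Q0)) $ i $ j) \<le> K"
    then have T: "\<And>i j. cmod (T $ i $ j) \<le> K" by (simp add: T_def)
    have "cmod (det T) * norm (P *v v) \<le> L * norm ((B ** P) *v v)"
    proof (cases "det T = 0")
      case True
      then show ?thesis using L by simp
    next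
      case False
      let ?b = "E *v ((B ** P) *v v)"
      obtain y where y: "T *v y = ?b"
        using cramer[OF False] by blast
      have "P *v v = P *v y"
        by (rule solve_through_smaller_vector[OF assms rk]) (use False y in \<open>auto simp: T_def\<close>)
      then have "cmod (det T) * norm (P *v v) \<le> cmod (det T) * (K' * norm y)"
        using order_trans[OF opnorm_bound mult_right_mono[of "opnorm P" K' "norm y"]] P
        by (intro mult_left_mono) (auto simp: K'_def)
      also have "\<dots> = K' * (cmod (det T) * norm y)"
        by simp
      also have "\<dots> \<le> K' * (C * norm ?b)"
        using C(2)[OF T, of y] by (intro mult_left_mono) (auto simp: y K'_def)
      also have "\<dots> \<le> K' * (C * ((opnorm E + 1) * norm ((B ** P) *v v)))"
        using C(1) order_trans[OF opnorm_bound mult_right_mono[of "opnorm E" "opnorm E + 1"]]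
        by (intro mult_left_mono) (auto simp: K'_def)
      finally show ?thesis by (simp add: L_def mult_ac)
    qed
    then show "1 / L * cmod (det (E ** (B ** P) + (mat 1 - E ** Q0))) * norm (P *v v) \<le> norm ((B ** P) *v v)"
      using L by (simp add: T_def field_simps)
  qed (use L in simp)
qed

section \<open>The largest singular value\<close>

lemma inner_conj_transpose:
  fixes M :: "complex ^ 'n ^ 'm"
  shows "(M *v u) \<bullet> w = u \<bullet> (conj_transpose M *v w)"
proof -
  have c: "a \<bullet> b = Re (cnj a * b)" for a b :: complex
    by (simp add: inner_complex_def)
  have "(M *v u) \<bullet> w = (\<Sum>i\<in>UNIV. \<Sum>j\<in>UNIV. Re (cnj (M $ i $ j) * cnj (u $ j) * w $ i))"
    by (simp add: inner_vec_def c matrix_vector_mult_def sum_distrib_right)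
  also have "\<dots> = (\<Sum>j\<in>UNIV. \<Sum>i\<in>UNIV. Re (cnj (M $ i $ j) * cnj (u $ j) * w $ i))"
    by (rule sum.swap)
  also have "\<dots> = u \<bullet> (conj_transpose M *v w)"
    by (simp add: inner_vec_def c matrix_vector_mult_def sum_distrib_left conj_transpose_def
        transpose_def map_matrix_def mult_ac)
  finally show ?thesis .
qed

lemma opnorm_conj_transpose_le: "norm (conj_transpose M *v w) \<le> opnorm M * norm w"
proof -
  let ?u = "conj_transpose M *v w"
  have "norm ?u * norm ?u = ?u \<bullet> ?u"
    by (simp add: dot_square_norm power2_eq_square)
  also have "\<dots> = (M *v ?u) \<bullet> w"
    by (rule inner_conj_transpose[symmetric])
  also have "\<dots> \<le> norm (M *v ?u) * norm w"
    by (rule norm_cauchy_schwarz)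
  also have "\<dots> \<le> (opnorm M * norm ?u) * norm w"
    by (intro mult_right_mono opnorm_bound) auto
  finally have "norm ?u * norm ?u \<le> (opnorm M * norm w) * norm ?u"
    by (simp add: mult_ac)
  then show ?thesis
    by (cases "norm ?u = 0") (auto simp: opnorm_nonneg)
qed

lemma poly_det_pointwise:
  "poly (det P) z = det (map_matrix (\<lambda>p. poly p z) P)" for P :: "complex poly ^ 'n ^ 'n"
  by (simp add: det_def poly_sum poly_prod map_matrix_def)

text \<open>Evaluating polynomial entries commutes with the determinant, so the roots are the eigenvalues.\<close>

lemma poly_charpoly_eq_0_iff:
  "poly (charpoly B) z = 0 \<longleftrightarrow> (\<exists>v. v \<noteq> 0 \<and> B *v v = z *s v)"
proof -
  have "map_matrix (\<lambda>p. poly p z) (mat [:0, 1:] - map_matrix (\<lambda>z. [:z:]) B) = mat z - B"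
    by (simp add: map_matrix_def vec_eq_iff mat_def)
  then have "poly (charpoly B) z = 0 \<longleftrightarrow> \<not> invertible (mat z - B)"
    by (simp add: charpoly_def poly_det_pointwise invertible_det_nz)
  also have "\<dots> \<longleftrightarrow> (\<exists>v. v \<noteq> 0 \<and> (mat z - B) *v v = 0)"
    by (auto simp: invertible_left_inverse matrix_left_invertible_ker)
  also have "\<dots> \<longleftrightarrow> (\<exists>v. v \<noteq> 0 \<and> B *v v = z *s v)"
  proof -
    have "mat z *v v = z *s v" for v :: "complex^'a"
      by (simp add: vec_eq_iff matrix_vector_mult_def mat_def if_distrib if_distribR cong: if_cong)
    then show ?thesis
      by (metis matrix_vector_mult_diff_rdistrib right_minus_eq)
  qed
  finally show ?thesis .
qed

lemma inner_mult_vec_self: "v \<bullet> (z *s v) = Re z * (norm v)\<^sup>2" for v :: "complex ^ 'n"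
proof -
  have "v \<bullet> (z *s v) = (\<Sum>i\<in>UNIV. Re z * (cmod (v $ i))\<^sup>2)"
    unfolding inner_vec_def inner_complex_def cmod_power2
    by (intro sum.cong refl) (simp add: algebra_simps power2_eq_square)
  also have "\<dots> = Re z * (norm v)\<^sup>2"
    by (simp add: norm_vec_def L2_set_def sum_nonneg sum_distrib_left)
  finally show ?thesis .
qed

lemma sqrt_Re_eigenvalue_le_opnorm:
  assumes "v \<noteq> 0" "(conj_transpose M ** M) *v v = z *s v"
  shows "sqrt (Re z) \<le> opnorm M"
proof -
  have "Re z * (norm v)\<^sup>2 = v \<bullet> ((conj_transpose M ** M) *v v)"
    by (simp add: assms(2) inner_mult_vec_self)
  also have "\<dots> = (M *v v) \<bullet> (M *v v)"
    by (simp add: inner_conj_transpose matrix_vector_mul_assoc[symmetric])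
  also have "\<dots> = (norm (M *v v))\<^sup>2"
    by (rule dot_square_norm)
  also have "\<dots> \<le> (opnorm M * norm v)\<^sup>2"
    by (intro power_mono opnorm_bound) auto
  finally have "Re z \<le> (opnorm M)\<^sup>2"
    using assms(1) by (simp add: power_mult_distrib)
  then show ?thesis
    using opnorm_nonneg by (intro real_le_lsqrt)
qed

text \<open>The norm of \<open>M *v w\<close> on the unit sphere is maximal at some \<open>v\<close>. With \<open>s\<close> the operator norm and
  \<open>h = M\<^sup>* M v\<close>, the square of the norm of \<open>h - s\<^sup>2 v\<close> expands to the square of the norm of \<open>h\<close> minus
  \<open>s\<^sup>4\<close>, which is at most 0 because the adjoint does not have a larger norm than \<open>M\<close>.\<close>

lemma opnorm_squared_eigenvalue:
  obtains v where "v \<noteq> 0"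
    "(conj_transpose M ** M) *v v = complex_of_real ((opnorm M)\<^sup>2) *s v"
proof -
  let ?s = "opnorm M" and ?S = "sphere (0 :: complex ^ 'a) 1"
  have "?S \<noteq> {}"
    by simp
  then obtain v where v: "norm v = 1" and max: "\<And>w. norm w = 1 \<Longrightarrow> norm (M *v w) \<le> norm (M *v v)"
    using continuous_attains_sup[OF compact_sphere _ continuous_on_norm[OF matrix_vector_mult_linear_continuous_on], of 0 1 M]
    by auto
  have "norm (M *v w) \<le> norm (M *v v) * norm w" for w
  proof (cases "w = 0")
    case False
    have "norm (M *v ((1 / norm w) *\<^sub>R w)) \<le> norm (M *v v)"
      by (rule max) (use False in simp)
    moreover have "M *v ((1 / norm w) *\<^sub>R w) = (1 / norm w) *\<^sub>R (M *v w)"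
      by (metis linear_scale bounded_linear.linear matrix_vector_mul_bounded_linear)
    ultimately show ?thesis
      using False by (simp add: field_simps)
  qed auto
  then have "?s \<le> norm (M *v v)"
    by (rule onorm_le)
  then have s: "norm (M *v v) = ?s"
    using opnorm_bound[of M v] v by simp
  let ?h = "(conj_transpose M ** M) *v v"
  have h: "?h = conj_transpose M *v (M *v v)"
    by (simp add: matrix_vector_mul_assoc)
  have "norm ?h \<le> ?s * ?s"
    using opnorm_conj_transpose_le[of M "M *v v"] by (simp add: h s)
  then have "(norm ?h)\<^sup>2 \<le> (?s * ?s)\<^sup>2"
    by (intro power_mono) auto
  moreover have "?h \<bullet> v = ?s\<^sup>2"
    using inner_conj_transpose[of M v "M *v v"] by (simp add: h s dot_square_norm inner_commute)
  moreover have "(norm (?h - ?s\<^sup>2 *\<^sub>R v))\<^sup>2 = (norm ?h)\<^sup>2 - 2 * ?s\<^sup>2 * (?h \<bullet> v) + (?s\<^sup>2)\<^sup>2 * (norm v)\<^sup>2"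
    unfolding dot_square_norm[symmetric]
    by (simp add: inner_diff_left inner_diff_right inner_commute algebra_simps power2_eq_square)
  ultimately have "(norm (?h - ?s\<^sup>2 *\<^sub>R v))\<^sup>2 \<le> 0"
    by (simp add: v power2_eq_square)
  then have "?h = ?s\<^sup>2 *\<^sub>R v"
    by simp
  moreover have "c *\<^sub>R v = complex_of_real c *s v" for c
    by (simp add: vec_eq_iff complex_eq_iff)
  ultimately show thesis
    using that[of v] v by fastforce
qed

text \<open>All roots of the characteristic polynomial satisfy \<open>sqrt (Re z) \<le> opnorm M\<close>, and the value
  \<open>opnorm M\<close> occurs, so it is the first entry of the decreasing list.\<close>

lemma singular_value_1: "singular_value 1 M = opnorm M"
proof -
  let ?p = "charpoly (conj_transpose M ** M)"
  define m where "m = image_mset (\<lambda>z. sqrt (Re z)) (proots ?p)"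
  have root_le: "sqrt (Re z) \<le> opnorm M" if "poly ?p z = 0" for z
    using that sqrt_Re_eigenvalue_le_opnorm unfolding poly_charpoly_eq_0_iff by blast
  \<comment> \<open>Only for a nonzero polynomial does \<open>proots\<close> list the roots. If it were zero, every number would
    be an eigenvalue, also one that exceeds the bound.\<close>
  have "?p \<noteq> 0"
  proof
    assume "?p = 0"
    then have "sqrt (Re (complex_of_real ((opnorm M + 1)\<^sup>2))) \<le> opnorm M"
      by (intro root_le) simp
    then show False
      using opnorm_nonneg[of M] by simp
  qed
  then have set_m: "set_mset m = (\<lambda>z. sqrt (Re z)) ` {z. poly ?p z = 0}"
    by (simp add: m_def)
  then have le: "\<And>t. t \<in># m \<Longrightarrow> t \<le> opnorm M"
    using root_le by auto
  obtain v where "v \<noteq> 0" "(conj_transpose M ** M) *v v = complex_of_real ((opnorm M)\<^sup>2) *s v"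
    by (rule opnorm_squared_eigenvalue)
  then have "poly ?p (complex_of_real ((opnorm M)\<^sup>2)) = 0"
    unfolding poly_charpoly_eq_0_iff by blast
  then have "sqrt (Re (complex_of_real ((opnorm M)\<^sup>2))) \<in># m"
    unfolding set_m by blast
  then have mem: "opnorm M \<in># m"
    by (simp add: opnorm_nonneg)
  define xs where "xs = sorted_list_of_multiset m"
  have xs: "sorted xs" "set xs = set_mset m" "xs \<noteq> []"
    using mem by (auto simp: xs_def dest: arg_cong[of _ _ mset])
  have "singular_value 1 M = last xs"
    using xs(3) by (simp add: singular_value_def singular_values_def m_def[symmetric] xs_def[symmetric]
        rev_nth last_conv_nth)
  also have "last xs = opnorm M"
  proof (rule antisym)
    show "last xs \<le> opnorm M"
      using xs le last_in_set by metis
    show "opnorm M \<le> last xs"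
    proof -
      obtain i where "i < length xs" "opnorm M = xs ! i"
        using mem xs(2) by (metis in_set_conv_nth)
      then show ?thesis
        using xs sorted_nth_mono[OF xs(1), of i "length xs - 1"] by (simp add: last_conv_nth)
    qed
  qed
  finally show ?thesis .
qed

section \<open>Sublevel sets and integrability of logarithms\<close>

text \<open>The sublevel estimate of van der Corput type: if the \<open>k\<close>-th derivative is at least 1, the
  function is smaller than \<open>\<eta> ^ k\<close> only on a set of measure \<open>O(\<eta>)\<close>, with a constant that depends on \<open>k\<close>
  alone. In the induction step the \<open>k\<close>-th derivative is increasing. It is smaller than \<open>\<eta>\<close> only on a
  short interval, and on each of the two remaining intervals the induction hypothesis applies to
  \<open>u 0 / \<eta>\<close> up to sign. Here \<open>u j\<close> is the \<open>j\<close>-th derivative of \<open>u 0\<close>. The set is covered by a measurable set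
  instead of being measured itself, which removes measurability from the induction.\<close>

lemma sublevel_interval_cover:
  fixes u :: "nat \<Rightarrow> real \<Rightarrow> real"
  assumes "is_interval I" "\<eta> > 0"
    and "\<And>j t. j < k \<Longrightarrow> t \<in> I \<Longrightarrow> (u j has_real_derivative u (Suc j) t) (at t)"
    and "\<And>t. t \<in> I \<Longrightarrow> 1 \<le> u k t"
  shows "\<exists>B \<in> sets lborel. {t \<in> I. \<bar>u 0 t\<bar> < \<eta> ^ k} \<subseteq> B \<and>
    emeasure lborel B \<le> ennreal (4 * (2 ^ k - 1) * \<eta>)"
  using assms
proof (induction k arbitrary: u I)
  case 0
  then have "{t \<in> I. \<bar>u 0 t\<bar> < \<eta> ^ 0} \<subseteq> {}"
    by force
  then show ?case
    by (intro bexI[of _ "{}"]) auto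
next
  case (Suc k)
  have incr: "t - s \<le> u k t - u k s" if st: "s \<in> I" "t \<in> I" "s \<le> t" for s t
  proof (cases "s = t")
    case False
    have "{s..t} \<subseteq> I"
      using Suc.prems(1) st unfolding is_interval_1 by (meson atLeastAtMost_iff subsetI)
    then have "\<exists>z. s < z \<and> z < t \<and> u k t - u k s = (t - s) * u (Suc k) z"
      using False st Suc.prems(3)[of k] by (intro MVT2) auto
    then obtain z where z: "s < z" "z < t" "u k t - u k s = (t - s) * u (Suc k) z"
      by blast
    have "1 \<le> u (Suc k) z"
      using \<open>{s..t} \<subseteq> I\<close> z by (intro Suc.prems(4)) auto
    then show ?thesis
      unfolding z(3) using st mult_left_mono[of 1 "u (Suc k) z" "t - s"] by simp
  qed auto
  \<comment> \<open>The constants satisfy \<open>c (k + 1) = 4 + 2 * c k\<close> with \<open>c 0 = 0\<close>, hence \<open>c k = 4 * (2 ^ k - 1)\<close>.\<close>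
  have small: "\<exists>J \<in> sets lborel. {t \<in> I. \<bar>u k t\<bar> < \<eta>} \<subseteq> J \<and> emeasure lborel J \<le> ennreal (4 * \<eta>)"
  proof (cases "\<exists>s \<in> I. \<bar>u k s\<bar> < \<eta>")
    case True
    then obtain s where s: "s \<in> I" "\<bar>u k s\<bar> < \<eta>" by blast
    have "{t \<in> I. \<bar>u k t\<bar> < \<eta>} \<subseteq> {s - 2 * \<eta>..s + 2 * \<eta>}"
    proof
      fix t assume "t \<in> {t \<in> I. \<bar>u k t\<bar> < \<eta>}"
      then show "t \<in> {s - 2 * \<eta>..s + 2 * \<eta>}"
        using s incr[of s t] incr[of t s] by (cases "s \<le> t") auto
    qed
    moreover have "emeasure lborel {s - 2 * \<eta>..s + 2 * \<eta>} = ennreal (4 * \<eta>)"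
      using Suc.prems(2) by simp
    ultimately show ?thesis
      by (intro bexI[of _ "{s - 2 * \<eta>..s + 2 * \<eta>}"]) auto
  qed (auto intro!: bexI[of _ "{}"])
  have sign: "\<exists>B \<in> sets lborel. {t \<in> J. \<bar>u 0 t\<bar> < \<eta> ^ Suc k} \<subseteq> B \<and>
      emeasure lborel B \<le> ennreal (4 * (2 ^ k - 1) * \<eta>)"
    if J: "is_interval J" "J \<subseteq> I" and e: "\<bar>e\<bar> = 1" and ge: "\<And>t. t \<in> J \<Longrightarrow> \<eta> \<le> e * u k t" for J e
  proof -
    have "\<exists>B \<in> sets lborel. {t \<in> J. \<bar>(\<lambda>j t. e / \<eta> * u j t) 0 t\<bar> < \<eta> ^ k} \<subseteq> B \<and>
        emeasure lborel B \<le> ennreal (4 * (2 ^ k - 1) * \<eta>)"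
    proof (rule Suc.IH)
      show "((\<lambda>t. e / \<eta> * u j t) has_real_derivative e / \<eta> * u (Suc j) t) (at t)"
        if "j < k" "t \<in> J" for j t
        using that J Suc.prems(3)[of j t] by (intro DERIV_cmult) auto
      show "1 \<le> e / \<eta> * u k t" if "t \<in> J" for t
        using ge[OF that] Suc.prems(2) by (simp add: field_simps)
    qed (use J Suc.prems in auto)
    moreover have "{t \<in> J. \<bar>e / \<eta> * u 0 t\<bar> < \<eta> ^ k} = {t \<in> J. \<bar>u 0 t\<bar> < \<eta> ^ Suc k}"
      using Suc.prems(2) e by (auto simp: abs_mult field_simps)
    ultimately show ?thesis by simp
  qed
  have "is_interval {t \<in> I. \<eta> \<le> u k t}" "is_interval {t \<in> I. u k t \<le> - \<eta>}"
  proof -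
    have mono: "u k s \<le> u k t" if "s \<in> I" "t \<in> I" "s \<le> t" for s t
      using incr[OF that] that by simp
    have I: "x \<in> I" if "a \<in> I" "b \<in> I" "a \<le> x" "x \<le> b" for a b x
      using Suc.prems(1) that unfolding is_interval_1 by blast
    show "is_interval {t \<in> I. \<eta> \<le> u k t}"
      unfolding is_interval_1
    proof (intro ballI allI impI CollectI)
      fix a b x assume *: "a \<in> {t \<in> I. \<eta> \<le> u k t}" "b \<in> {t \<in> I. \<eta> \<le> u k t}" "a \<le> x \<and> x \<le> b"
      then show "x \<in> I \<and> \<eta> \<le> u k x"
        using I[of a b x] mono[of a x] by simp
    qed
    show "is_interval {t \<in> I. u k t \<le> - \<eta>}"
      unfolding is_interval_1
    proof (intro ballI allI impI CollectI)
      fix a b x assume *: "a \<in> {t \<in> I. u k t \<le> - \<eta>}" "b \<in> {t \<in> I. u k t \<le> - \<eta>}" "a \<le> x \<and> x \<le> b"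
      then show "x \<in> I \<and> u k x \<le> - \<eta>"
        using I[of a b x] mono[of x b] by simp
    qed
  qed
  then obtain B1 B2 where
    B1: "B1 \<in> sets lborel" "{t \<in> {t \<in> I. \<eta> \<le> u k t}. \<bar>u 0 t\<bar> < \<eta> ^ Suc k} \<subseteq> B1"
      "emeasure lborel B1 \<le> ennreal (4 * (2 ^ k - 1) * \<eta>)" and
    B2: "B2 \<in> sets lborel" "{t \<in> {t \<in> I. u k t \<le> - \<eta>}. \<bar>u 0 t\<bar> < \<eta> ^ Suc k} \<subseteq> B2"
      "emeasure lborel B2 \<le> ennreal (4 * (2 ^ k - 1) * \<eta>)"
    using sign[of "{t \<in> I. \<eta> \<le> u k t}" 1] sign[of "{t \<in> I. u k t \<le> - \<eta>}" "-1"] by auto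
  obtain J where J: "J \<in> sets lborel" "{t \<in> I. \<bar>u k t\<bar> < \<eta>} \<subseteq> J" "emeasure lborel J \<le> ennreal (4 * \<eta>)"
    using small by blast
  show ?case
  proof (intro bexI[of _ "J \<union> B1 \<union> B2"] conjI)
    show "{t \<in> I. \<bar>u 0 t\<bar> < \<eta> ^ Suc k} \<subseteq> J \<union> B1 \<union> B2"
      using J(2) B1(2) B2(2) by (auto simp: abs_less_iff not_less)
         (smt (verit, best) Collect_mem_eq Collect_mono_iff mem_Collect_eq subset_iff)
    have "emeasure lborel (J \<union> B1 \<union> B2) \<le> emeasure lborel (J \<union> B1) + emeasure lborel B2"
      using J(1) B1(1) B2(1) by (intro emeasure_subadditive) auto
    also have "\<dots> \<le> (emeasure lborel J + emeasure lborel B1) + emeasure lborel B2"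
      using J(1) B1(1) B2(1) by (intro add_mono emeasure_subadditive) auto
    also have "\<dots> \<le> (ennreal (4 * \<eta>) + ennreal (4 * (2 ^ k - 1) * \<eta>)) + ennreal (4 * (2 ^ k - 1) * \<eta>)"
      by (intro add_mono J B1 B2)
    also have "\<dots> = ennreal (4 * (2 ^ Suc k - 1) * \<eta>)"
      using Suc.prems(2) by (subst ennreal_plus[symmetric], simp, simp)+ (simp add: algebra_simps)
    finally show "emeasure lborel (J \<union> B1 \<union> B2) \<le> ennreal (4 * (2 ^ Suc k - 1) * \<eta>)" .
  qed (use J(1) B1(1) B2(1) in auto)
qed

text \<open>The negative part of the logarithm, infinite at 0. With values in the extended nonnegative reals,
  its integral against any measure makes sense without an integrability condition.\<close>

definition neglog :: "real \<Rightarrow> ennreal" where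
  "neglog t = (if t \<le> 0 then \<infinity> else ennreal (- ln t))"

lemma neglog_antimono: "s \<le> t \<Longrightarrow> neglog t \<le> neglog s"
  unfolding neglog_def by (auto intro!: ennreal_leI)

lemma neglog_mult_le: "neglog (s * t) \<le> neglog s + neglog t" if "0 \<le> s" "0 \<le> t"
proof (cases "s = 0 \<or> t = 0")
  case False
  then have pos: "0 < s" "0 < t" using that by auto
  have "ennreal (- ln (s * t)) \<le> ennreal (max 0 (- ln s) + max 0 (- ln t))"
    using pos by (intro ennreal_leI) (auto simp: ln_mult)
  also have "\<dots> = neglog s + neglog t"
    using pos by (simp add: neglog_def ennreal_max_0)
  finally show ?thesis
    using mult_pos_pos[OF pos] unfolding neglog_def[of "s * t"] by simp
qed (auto simp: neglog_def)

lemma neglog_prod_le: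
  assumes "\<And>i. i \<in> I \<Longrightarrow> 0 \<le> s i"
  shows "neglog (\<Prod>i\<in>I. s i) \<le> (\<Sum>i\<in>I. neglog (s i))"
  using assms
proof (induction I rule: infinite_finite_induct)
  case (insert i I)
  have "neglog (s i * (\<Prod>i\<in>I. s i)) \<le> neglog (s i) + neglog (\<Prod>i\<in>I. s i)"
    using insert.prems by (intro neglog_mult_le prod_nonneg) auto
  also have "\<dots> \<le> neglog (s i) + (\<Sum>i\<in>I. neglog (s i))"
    using insert by (intro add_left_mono) auto
  finally show ?case
    using insert by simp
qed (auto simp: neglog_def)

lemma borel_measurable_neglog[measurable]: "neglog \<in> borel_measurable borel"
  unfolding neglog_def by measurable

text \<open>A discrete layer cake: a level \<open>t\<close> below the first \<open>m\<close> thresholds \<open>c * (1 / 2 ^ n) ^ k\<close> pays \<open>m\<close> times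
  the constant increment \<open>k * ln 2\<close> of \<open>- ln\<close> between consecutive thresholds. Using \<open>k + 1\<close> instead
  of \<open>k\<close> covers \<open>k = 0\<close>, where all thresholds coincide.\<close>

lemma neglog_le_sum_indicators:
  assumes "0 < c" "c \<le> 1" "0 \<le> t"
  shows "neglog t \<le> ennreal (- ln c) +
    (\<Sum>n. ennreal (real (Suc k) * ln 2) * indicator {s. s < c * (1 / 2 ^ n) ^ k} t)" (is "_ \<le> _ + suminf ?f")
proof (cases "\<forall>n. t < c * (1 / 2 ^ n) ^ k")
  case True
  have "(\<Sum>n. ennreal (real (Suc k) * ln 2)) = \<infinity>"
  proof -
    have "(\<Sum>n. ennreal (real (Suc k) * ln 2)) = emeasure (count_space (UNIV::nat set)) UNIV * ennreal (real (Suc k) * ln 2)"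
      by (subst nn_integral_count_space_nat[symmetric]) (simp add: mult.commute del: of_nat_Suc)
    also have "\<dots> = \<infinity>"
      by (simp add: ennreal_top_mult)
    finally show ?thesis .
  qed
  then have "suminf ?f = \<infinity>"
    using True by simp
  then show ?thesis by simp
next
  case False
  define m where "m = (LEAST n. \<not> t < c * (1 / 2 ^ n) ^ k)"
  have m: "c * (1 / 2 ^ m) ^ k \<le> t" "\<And>n. n < m \<Longrightarrow> t < c * (1 / 2 ^ n) ^ k"
  proof -
    have "\<exists>n. \<not> t < c * (1 / 2 ^ n) ^ k" using False by blast
    from LeastI_ex[OF this] show "c * (1 / 2 ^ m) ^ k \<le> t"
      unfolding m_def by (simp only: not_less)
    show "t < c * (1 / 2 ^ n) ^ k" if "n < m" for n
      using not_less_Least[OF that[unfolded m_def]] by blast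
  qed
  have pos: "0 < c * (1 / 2 ^ m) ^ k"
    using assms by simp
  have "neglog t \<le> neglog (c * (1 / 2 ^ m) ^ k)"
    by (rule neglog_antimono[OF m(1)])
  also have "\<dots> = ennreal (- ln c + real m * (real k * ln 2))"
    using pos assms by (auto simp: neglog_def ln_mult ln_realpow ln_div not_le algebra_simps)
  also have "\<dots> \<le> ennreal (- ln c + real m * (real (Suc k) * ln 2))"
    by (intro ennreal_leI add_left_mono mult_left_mono mult_right_mono) auto
  also have "\<dots> = ennreal (- ln c) + (\<Sum>n<m. ennreal (real (Suc k) * ln 2))"
    using assms by (subst ennreal_plus) (auto simp: ennreal_mult ennreal_of_nat_eq_real_of_nat)
  also have "(\<Sum>n<m. ennreal (real (Suc k) * ln 2)) = (\<Sum>n<m. ?f n)"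
    using m(2) by (intro sum.cong refl) simp
  also have "\<dots> \<le> suminf ?f"
    by (rule sum_le_suminf) auto
  finally show ?thesis by (simp add: add_left_mono)
qed

text \<open>The thresholds of the layer cake correspond to \<open>\<eta> = 1 / 2 ^ n\<close>, so that a power-type sublevel
  estimate leaves a geometric series.\<close>

lemma nn_integral_neglog_finite:
  fixes u :: "'a \<Rightarrow> real"
  assumes u[measurable]: "u \<in> borel_measurable M" and W[measurable]: "W \<in> sets M"
    and fin: "emeasure M W < \<infinity>" and u0: "\<And>x. 0 \<le> u x"
    and c: "0 < c" "c \<le> 1"
    and sub: "\<And>\<eta>. 0 < \<eta> \<Longrightarrow> emeasure M {x \<in> W. u x < c * \<eta> ^ k} \<le> ennreal (C * \<eta>)"
  shows "(\<integral>\<^sup>+x. neglog (u x) * indicator W x \<partial>M) < \<infinity>"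
proof -
  have C: "0 \<le> C \<or> (\<forall>\<eta>>0. ennreal (C * \<eta>) = 0)"
    by (auto simp: ennreal_neg mult_nonpos_nonneg not_le)
  let ?a = "ennreal (real (Suc k) * ln 2)"
  let ?S = "\<lambda>n::nat. {x \<in> W. u x < c * (1 / 2 ^ n) ^ k}"
  have S[measurable]: "?S n \<in> sets M" for n
  proof -
    have "?S n = W \<inter> (u -` {..< c * (1 / 2 ^ n) ^ k} \<inter> space M)"
      using sets.sets_into_space[OF W] by auto
    then show ?thesis by simp
  qed
  have "(\<integral>\<^sup>+x. neglog (u x) * indicator W x \<partial>M) \<le>
      (\<integral>\<^sup>+x. ennreal (- ln c) * indicator W x + (\<Sum>n. ?a * indicator (?S n) x) \<partial>M)"
  proof (rule nn_integral_mono)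
    fix x
    show "neglog (u x) * indicator W x \<le> ennreal (- ln c) * indicator W x + (\<Sum>n. ?a * indicator (?S n) x)"
    proof (cases "x \<in> W")
      case True
      have "indicator {s. s < c * (1 / 2 ^ n) ^ k} (u x) = (indicator (?S n) x :: ennreal)" for n
        using True by (auto simp: indicator_def)
      then show ?thesis
        using neglog_le_sum_indicators[OF c u0[of x], of k] True by simp
    qed simp
  qed
  also have "\<dots> = ennreal (- ln c) * emeasure M W + (\<Sum>n. ?a * emeasure M (?S n))"
    by (subst nn_integral_add, measurable)
       (simp add: nn_integral_suminf nn_integral_cmult_indicator del: ennreal_suminf_cmult)
  also have "\<dots> \<le> ennreal (- ln c) * emeasure M W + (\<Sum>n. ?a * ennreal (max 0 C * (1 / 2) ^ n))"
  proof (intro add_left_mono suminf_le mult_left_mono)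
    show "emeasure M (?S n) \<le> ennreal (max 0 C * (1 / 2) ^ n)" for n
    proof -
      have "emeasure M (?S n) \<le> ennreal (C * (1 / 2 ^ n))"
        by (rule sub) simp
      also have "\<dots> \<le> ennreal (max 0 C * (1 / 2) ^ n)"
        by (intro ennreal_leI) (auto simp: power_one_over divide_simps)
      finally show ?thesis .
    qed
  qed auto
  also have "(\<Sum>n. ?a * ennreal (max 0 C * (1 / 2) ^ n)) = ennreal (\<Sum>n. (real (Suc k) * ln 2) * (max 0 C * (1 / 2) ^ n))"
    by (subst suminf_ennreal2[symmetric])
       (auto simp: ennreal_mult[symmetric] simp del: of_nat_Suc intro!: summable_mult summable_geometric)
  finally show ?thesis
    using fin by (auto simp: ennreal_mult_less_top order_le_less_trans)
qed

section \<open>Holomorphic extensions of real analytic functions\<close>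

definition cvec :: "real ^ 'l \<Rightarrow> complex ^ 'l" where
  "cvec x = (\<chi> i. complex_of_real (x $ i))"

lemma cvec_nth [simp]: "cvec x $ i = complex_of_real (x $ i)"
  by (simp add: cvec_def)

lemma dist_cvec [simp]: "dist (cvec x) (cvec y) = dist x y"
  by (simp add: dist_vec_def)

lemma norm_cvec [simp]: "norm (cvec x) = norm x"
  by (simp add: norm_vec_def)

lemma continuous_on_cvec [continuous_intros]: "continuous_on S cvec"
  unfolding continuous_on_iff by auto

lemma norm_mult_vec: "norm (z *s v) = cmod z * norm v" for v :: "complex ^ 'n"
  by (simp add: norm_vec_def norm_mult L2_set_right_distrib)

text \<open>This notion of holomorphy in several variables is tested on holomorphic curves. It is what
  composition needs, it restricts to lines as ordinary holomorphy in one variable, and power series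
  have it by uniform convergence, without several-variable derivatives.\<close>

definition curve_holomorphic :: "(complex ^ 'l) set \<Rightarrow> (complex ^ 'l \<Rightarrow> complex) \<Rightarrow> bool" where
  "curve_holomorphic U H \<longleftrightarrow> continuous_on U H \<and>
     (\<forall>D \<gamma>. open D \<longrightarrow> (\<forall>i. (\<lambda>z. \<gamma> z $ i) holomorphic_on D) \<longrightarrow> \<gamma> ` D \<subseteq> U \<longrightarrow>
        (\<lambda>z. H (\<gamma> z)) holomorphic_on D)"

text \<open>Real analyticity as existence of a holomorphic extension to a complex ball. In contrast to
  power series, this form is visibly stable under sums, products and composition.\<close>

definition extendable_at :: "(real ^ 'l \<Rightarrow> complex) \<Rightarrow> real ^ 'l \<Rightarrow> bool" where
  "extendable_at g a \<longleftrightarrow>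
     (\<exists>r>0. \<exists>H. curve_holomorphic (ball (cvec a) r) H \<and> (\<forall>y\<in>ball a r. g y = H (cvec y)))"

lemma curve_holomorphicD:
  assumes "curve_holomorphic U H" "open D" "\<And>i. (\<lambda>z. \<gamma> z $ i) holomorphic_on D" "\<gamma> ` D \<subseteq> U"
  shows "(\<lambda>z. H (\<gamma> z)) holomorphic_on D"
  using assms unfolding curve_holomorphic_def by blast

lemma curve_holomorphic_imp_continuous_on: "curve_holomorphic U H \<Longrightarrow> continuous_on U H"
  unfolding curve_holomorphic_def by blast

lemma curve_holomorphic_subset: "curve_holomorphic U H \<Longrightarrow> V \<subseteq> U \<Longrightarrow> curve_holomorphic V H"
  unfolding curve_holomorphic_def by (meson continuous_on_subset order_trans)

lemma curve_holomorphic_const: "curve_holomorphic U (\<lambda>_. c)"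
  unfolding curve_holomorphic_def by auto

lemma curve_holomorphic_add:
  "curve_holomorphic U H \<Longrightarrow> curve_holomorphic U K \<Longrightarrow> curve_holomorphic U (\<lambda>w. H w + K w)"
  unfolding curve_holomorphic_def by (auto intro!: continuous_intros holomorphic_on_add)

lemma curve_holomorphic_mult:
  "curve_holomorphic U H \<Longrightarrow> curve_holomorphic U K \<Longrightarrow> curve_holomorphic U (\<lambda>w. H w * K w)"
  unfolding curve_holomorphic_def by (auto intro!: continuous_intros holomorphic_on_mult)

lemma curve_holomorphic_compose:
  assumes F: "\<And>i. curve_holomorphic U (F i)" and K: "curve_holomorphic V K"
    and UV: "\<And>w. w \<in> U \<Longrightarrow> (\<chi> i. F i w) \<in> V"
  shows "curve_holomorphic U (\<lambda>w. K (\<chi> i. F i w))"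
  unfolding curve_holomorphic_def
proof (intro conjI allI impI)
  show "continuous_on U (\<lambda>w. K (\<chi> i. F i w))"
  proof (rule continuous_on_compose2[OF curve_holomorphic_imp_continuous_on[OF K]])
    show "continuous_on U (\<lambda>w. \<chi> i. F i w)"
      by (intro continuous_on_vec_lambda curve_holomorphic_imp_continuous_on F)
  qed (use UV in auto)
  fix D \<gamma> assume D: "open D" "\<forall>i. (\<lambda>z. \<gamma> z $ i) holomorphic_on D" "\<gamma> ` D \<subseteq> U"
  show "(\<lambda>z. K (\<chi> i. F i (\<gamma> z))) holomorphic_on D"
    by (rule curve_holomorphicD[OF K D(1)])
       (use UV D curve_holomorphicD[OF F D(1), of \<gamma>] in auto)
qed

lemma extendable_at_radius:
  assumes "curve_holomorphic (ball (cvec a) r) H" "\<And>y. y \<in> ball a r \<Longrightarrow> g y = H (cvec y)" "0 < r"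
  shows "extendable_at g a"
  using assms unfolding extendable_at_def by blast

lemma extendable_at_binary:
  assumes "extendable_at g a" "extendable_at h a"
  obtains r H K where "0 < r" "curve_holomorphic (ball (cvec a) r) H" "curve_holomorphic (ball (cvec a) r) K"
    "\<And>y. y \<in> ball a r \<Longrightarrow> g y = H (cvec y)" "\<And>y. y \<in> ball a r \<Longrightarrow> h y = K (cvec y)"
proof -
  obtain r H s K where *: "0 < r" "0 < s" "curve_holomorphic (ball (cvec a) r) H"
      "curve_holomorphic (ball (cvec a) s) K"
      "\<forall>y\<in>ball a r. g y = H (cvec y)" "\<forall>y\<in>ball a s. h y = K (cvec y)"
    using assms unfolding extendable_at_def by blast
  show thesis
    by (rule that[of "min r s" H K])
       (use * in \<open>auto intro: curve_holomorphic_subset\<close>)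
qed

lemma extendable_at_const: "extendable_at (\<lambda>_. c) a"
  by (rule extendable_at_radius[OF curve_holomorphic_const, of _ 1]) auto

lemma extendable_at_add:
  assumes "extendable_at g a" "extendable_at h a"
  shows "extendable_at (\<lambda>y. g y + h y) a"
proof -
  obtain r H K where *: "0 < r" "curve_holomorphic (ball (cvec a) r) H" "curve_holomorphic (ball (cvec a) r) K"
    "\<And>y. y \<in> ball a r \<Longrightarrow> g y = H (cvec y)" "\<And>y. y \<in> ball a r \<Longrightarrow> h y = K (cvec y)"
    using extendable_at_binary[OF assms] by metis
  show ?thesis
    by (rule extendable_at_radius[OF curve_holomorphic_add[OF *(2,3)] _ *(1)]) (simp add: *(4,5))
qed

lemma extendable_at_mult:
  assumes "extendable_at g a" "extendable_at h a"
  shows "extendable_at (\<lambda>y. g y * h y) a"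
proof -
  obtain r H K where *: "0 < r" "curve_holomorphic (ball (cvec a) r) H" "curve_holomorphic (ball (cvec a) r) K"
    "\<And>y. y \<in> ball a r \<Longrightarrow> g y = H (cvec y)" "\<And>y. y \<in> ball a r \<Longrightarrow> h y = K (cvec y)"
    using extendable_at_binary[OF assms] by metis
  show ?thesis
    by (rule extendable_at_radius[OF curve_holomorphic_mult[OF *(2,3)] _ *(1)]) (simp add: *(4,5))
qed

lemma extendable_at_cong:
  assumes "extendable_at g a" "eventually (\<lambda>y. g y = h y) (nhds a)"
  shows "extendable_at h a"
proof -
  obtain r H where *: "0 < r" "curve_holomorphic (ball (cvec a) r) H" "\<forall>y\<in>ball a r. g y = H (cvec y)"
    using assms(1) unfolding extendable_at_def by blast
  obtain s where s: "0 < s" "\<And>y. dist y a < s \<Longrightarrow> g y = h y"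
    using assms(2) unfolding eventually_nhds_metric by blast
  show ?thesis
    by (rule extendable_at_radius[of _ "min r s" H])
       (use * s(1) s(2)[symmetric] in \<open>auto intro: curve_holomorphic_subset simp: dist_commute\<close>)
qed

lemma extendable_at_imp_isCont:
  assumes "extendable_at g a"
  shows "isCont g a"
proof -
  obtain r H where *: "0 < r" "curve_holomorphic (ball (cvec a) r) H" "\<forall>y\<in>ball a r. g y = H (cvec y)"
    using assms unfolding extendable_at_def by blast
  have "continuous_on (ball a r) (\<lambda>y. H (cvec y))"
    by (rule continuous_on_compose2[OF curve_holomorphic_imp_continuous_on[OF *(2)] continuous_on_cvec]) auto
  then have "continuous_on (ball a r) g"
    using *(3) by (metis (no_types, lifting) continuous_on_cong)
  then show ?thesis
    using *(1) by (simp add: continuous_on_eq_continuous_at)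
qed

lemma extendable_at_compose:
  fixes g :: "real ^ 'l \<Rightarrow> real ^ 'm"
  assumes g: "\<And>i. extendable_at (\<lambda>y. complex_of_real (g y $ i)) a" and h: "extendable_at h (g a)"
  shows "extendable_at (\<lambda>y. h (g y)) a"
proof -
  obtain R K where K: "0 < R" "curve_holomorphic (ball (cvec (g a)) R) K"
      "\<And>y. y \<in> ball (g a) R \<Longrightarrow> h y = K (cvec y)"
    using h unfolding extendable_at_def by blast
  obtain r F where F: "\<And>i. 0 < r i" "\<And>i. curve_holomorphic (ball (cvec a) (r i)) (F i)"
      "\<And>i y. y \<in> ball a (r i) \<Longrightarrow> complex_of_real (g y $ i) = F i (cvec y)"
    using g unfolding extendable_at_def by metis
  define s where "s = Min (range r)"
  have s: "0 < s" "\<And>i. s \<le> r i"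
    using F(1) by (auto simp: s_def)
  have Fs: "curve_holomorphic (ball (cvec a) s) (F i)" for i
    using F(2)[of i] by (rule curve_holomorphic_subset) (use s(2)[of i] in auto)
  have eq: "(\<chi> i. F i (cvec y)) = cvec (g y)" if "y \<in> ball a s" for y
  proof -
    have "F i (cvec y) = complex_of_real (g y $ i)" for i
      using that s(2)[of i] by (intro F(3)[symmetric]) simp
    then show ?thesis
      by (simp add: vec_eq_iff)
  qed
  let ?F = "\<lambda>w. \<chi> i. F i w"
  have "continuous_on (ball (cvec a) s) ?F"
    by (intro continuous_on_vec_lambda curve_holomorphic_imp_continuous_on Fs)
  then have "isCont ?F (cvec a)"
    using s(1) by (simp add: continuous_on_eq_continuous_at)
  then obtain e where e: "0 < e" "\<And>w. dist w (cvec a) < e \<Longrightarrow> dist (?F w) (?F (cvec a)) < R"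
    using K(1) unfolding continuous_at_eps_delta by blast
  define t where "t = min s e"
  show ?thesis
  proof (rule extendable_at_radius[of _ t "\<lambda>w. K (?F w)"])
    show "curve_holomorphic (ball (cvec a) t) (\<lambda>w. K (?F w))"
    proof (rule curve_holomorphic_compose[OF _ K(2)])
      show "curve_holomorphic (ball (cvec a) t) (F i)" for i
        using Fs by (rule curve_holomorphic_subset) (auto simp: t_def)
      show "?F w \<in> ball (cvec (g a)) R" if "w \<in> ball (cvec a) t" for w
        using e(2)[of w] that eq[of a] s(1) by (simp add: t_def dist_commute)
    qed
    show "h (g y) = K (?F (cvec y))" if y: "y \<in> ball a t" for y
    proof -
      have "dist (?F (cvec y)) (?F (cvec a)) < R"
        using e(2)[of "cvec y"] y by (simp add: t_def dist_commute)
      then show ?thesis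
        using y eq[of y] eq[of a] s(1) K(3)[of "g y"] by (simp add: t_def dist_commute)
    qed
    show "0 < t" using s e by (simp add: t_def)
  qed
qed

lemma real_analytic_at_bounded_linear:
  assumes "real_analytic_at g a" "bounded_linear L"
  shows "real_analytic_at (\<lambda>x. L (g x)) a"
proof -
  interpret L: bounded_linear L by fact
  obtain r c where r: "r > 0" and c: "\<And>x. x \<in> ball a r \<Longrightarrow>
      ((\<lambda>\<alpha>. (\<Prod>i\<in>UNIV. (x $ i - a $ i) ^ \<alpha> i) *\<^sub>R c \<alpha>) has_sum g x) UNIV"
    using assms(1) unfolding real_analytic_at_def by blast
  show ?thesis
    unfolding real_analytic_at_def
  proof (intro exI[of _ r] conjI exI[of _ "\<lambda>\<alpha>. L (c \<alpha>)"] ballI)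
    fix x assume "x \<in> ball a r"
    from has_sum_bounded_linear[OF assms(2) c[OF this]]
    show "((\<lambda>\<alpha>. (\<Prod>i\<in>UNIV. (x $ i - a $ i) ^ \<alpha> i) *\<^sub>R L (c \<alpha>)) has_sum L (g x)) UNIV"
      by (simp add: o_def L.scaleR)
  qed fact
qed

text \<open>Absolute convergence at the corner point with all coordinates \<open>\<rho>\<close> majorizes the series on the
  complex ball of radius \<open>\<rho>\<close>, and holomorphy along a curve passes to the uniform limit.\<close>

lemma power_series_curve_holomorphic:
  fixes a :: "real ^ 'l" and c :: "('l \<Rightarrow> nat) \<Rightarrow> complex"
  assumes \<rho>: "0 < \<rho>" and summable: "(\<lambda>\<alpha>. (\<Prod>i\<in>UNIV. \<rho> ^ \<alpha> i) * cmod (c \<alpha>)) summable_on UNIV"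
  defines "H \<equiv> \<lambda>w. \<Sum>\<^sub>\<infinity>\<alpha>. (\<Prod>i\<in>UNIV. (w $ i - complex_of_real (a $ i)) ^ \<alpha> i) * c \<alpha>"
  shows "curve_holomorphic (ball (cvec a) \<rho>) H"
    and "w \<in> ball (cvec a) \<rho> \<Longrightarrow>
      ((\<lambda>\<alpha>. (\<Prod>i\<in>UNIV. (w $ i - complex_of_real (a $ i)) ^ \<alpha> i) * c \<alpha>) has_sum H w) UNIV"
proof -
  let ?B = "ball (cvec a) \<rho>"
  let ?f = "\<lambda>\<alpha> w. (\<Prod>i\<in>UNIV. (w $ i - complex_of_real (a $ i)) ^ \<alpha> i) * c \<alpha>"
  let ?F = "finite_subsets_at_top (UNIV :: ('l \<Rightarrow> nat) set)"
  have bound: "norm (?f \<alpha> w) \<le> (\<Prod>i\<in>UNIV. \<rho> ^ \<alpha> i) * cmod (c \<alpha>)" if "w \<in> ?B" for \<alpha> w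
  proof -
    have "cmod (w $ i - complex_of_real (a $ i)) \<le> \<rho>" for i
    proof -
      have "cmod (w $ i - complex_of_real (a $ i)) = cmod ((w - cvec a) $ i)"
        by simp
      also have "\<dots> \<le> norm (w - cvec a)"
        by (rule Finite_Cartesian_Product.norm_nth_le)
      finally show ?thesis
        using that by (simp add: dist_norm norm_minus_commute)
    qed
    then show ?thesis
      unfolding norm_mult prod_norm[symmetric] norm_power
      by (intro mult_right_mono prod_mono conjI power_mono) auto
  qed
  have ul: "uniform_limit ?B (\<lambda>X w. \<Sum>\<alpha>\<in>X. ?f \<alpha> w) H ?F"
    unfolding H_def using bound summable by (rule Weierstrass_m_test_general)
  show "((\<lambda>\<alpha>. ?f \<alpha> w) has_sum H w) UNIV" if "w \<in> ?B"
  proof -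
    have "(\<lambda>\<alpha>. norm (?f \<alpha> w)) summable_on UNIV"
      using summable bound[OF that] by (rule summable_on_comparison_test) auto
    then have "(\<lambda>\<alpha>. ?f \<alpha> w) summable_on UNIV"
      by (rule abs_summable_summable)
    then show ?thesis
      unfolding H_def by (rule has_sum_infsum)
  qed
  show "curve_holomorphic ?B H"
    unfolding curve_holomorphic_def
  proof (intro conjI allI impI)
    show "continuous_on ?B H"
      by (rule uniform_limit_theorem[OF _ ul]) (auto intro!: always_eventually continuous_intros)
    fix D \<gamma> assume D: "open D" "\<forall>i. (\<lambda>z. \<gamma> z $ i) holomorphic_on D" "\<gamma> ` D \<subseteq> ?B"
    have ulD: "uniform_limit D (\<lambda>X z. \<Sum>\<alpha>\<in>X. ?f \<alpha> (\<gamma> z)) (\<lambda>z. H (\<gamma> z)) ?F"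
      using uniform_limit_compose'[OF ul, of \<gamma> D] D(3) by auto
    have holD: "(\<lambda>z. \<Sum>\<alpha>\<in>X. ?f \<alpha> (\<gamma> z)) holomorphic_on D" for X
      using D(2) by (intro holomorphic_intros) auto
    show "(\<lambda>z. H (\<gamma> z)) holomorphic_on D"
    proof (subst holomorphic_on_open[OF D(1)], intro ballI)
      fix z assume "z \<in> D"
      then obtain e where e: "e > 0" "cball z e \<subseteq> D"
        using D(1) open_contains_cball by blast
      have "(\<lambda>z. H (\<gamma> z)) holomorphic_on ball z e"
      proof (rule holomorphic_uniform_limit)
        show "\<forall>\<^sub>F X in ?F. continuous_on (cball z e) (\<lambda>z. \<Sum>\<alpha>\<in>X. ?f \<alpha> (\<gamma> z)) \<and>
            (\<lambda>z. \<Sum>\<alpha>\<in>X. ?f \<alpha> (\<gamma> z)) holomorphic_on ball z e"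
          by (intro always_eventually allI conjI holomorphic_on_imp_continuous_on)
             (use holomorphic_on_subset[OF holD] e(2) ball_subset_cball in blast)+
        show "uniform_limit (cball z e) (\<lambda>X z. \<Sum>\<alpha>\<in>X. ?f \<alpha> (\<gamma> z)) (\<lambda>z. H (\<gamma> z)) ?F"
          using ulD e(2) by (rule uniform_limit_on_subset)
      qed auto
      then show "\<exists>f'. ((\<lambda>z. H (\<gamma> z)) has_field_derivative f') (at z)"
        using e(1) by (simp add: holomorphic_on_open)
    qed
  qed
qed

text \<open>The point \<open>x0\<close> with all coordinates of \<open>x0 - a\<close> equal to \<open>\<rho>\<close> lies in the ball of convergence, and
  unconditional convergence of complex numbers is absolute.\<close>

lemma real_analytic_at_imp_extendable_at:
  assumes "real_analytic_at g a"
  shows "extendable_at g a"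
proof -
  obtain r c where r: "r > 0" and c: "\<And>x. x \<in> ball a r \<Longrightarrow>
      ((\<lambda>\<alpha>. (\<Prod>i\<in>UNIV. (x $ i - a $ i) ^ \<alpha> i) *\<^sub>R c \<alpha>) has_sum g x) UNIV"
    using assms unfolding real_analytic_at_def by blast
  define \<rho> where "\<rho> = r / (2 * CARD('a))"
  have \<rho>: "0 < \<rho>" "\<rho> \<le> r"
  proof -
    have "1 \<le> real CARD('a)"
      using zero_less_card_finite[where 'a='a] by linarith
    then have "1 \<le> real CARD('a) * 2"
      by linarith
    then show "0 < \<rho>" "\<rho> \<le> r"
      using r by (auto simp: \<rho>_def field_simps)
  qed
  define x0 where "x0 = a + (\<chi> i. \<rho>)"
  have "norm (\<chi> i::'a. \<rho>) \<le> (\<Sum>i\<in>(UNIV::'a set). \<rho>)"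
    using norm_le_l1_cart[of "\<chi> i::'a. \<rho>"] \<rho>(1) by simp
  also have "\<dots> < r"
    using r by (simp add: \<rho>_def)
  finally have "x0 \<in> ball a r"
    by (simp add: x0_def dist_norm norm_minus_commute)
  from c[OF this] have "(\<lambda>\<alpha>. (\<Prod>i\<in>UNIV. \<rho> ^ \<alpha> i) *\<^sub>R c \<alpha>) summable_on UNIV"
    by (auto simp: x0_def summable_on_def)
  then have "(\<lambda>\<alpha>. norm ((\<Prod>i\<in>UNIV. \<rho> ^ \<alpha> i) *\<^sub>R c \<alpha>)) summable_on UNIV"
    by (simp only: summable_on_iff_abs_summable_on_complex)
  moreover have "norm ((\<Prod>i\<in>UNIV. \<rho> ^ \<alpha> i) *\<^sub>R c \<alpha>) = (\<Prod>i\<in>UNIV. \<rho> ^ \<alpha> i) * cmod (c \<alpha>)" for \<alpha>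
    using \<rho>(1) by (simp add: prod_nonneg)
  ultimately have summable: "(\<lambda>\<alpha>. (\<Prod>i\<in>UNIV. \<rho> ^ \<alpha> i) * cmod (c \<alpha>)) summable_on UNIV"
    by (simp only:)
  define H where "H = (\<lambda>w. \<Sum>\<^sub>\<infinity>\<alpha>. (\<Prod>i\<in>UNIV. (w $ i - complex_of_real (a $ i)) ^ \<alpha> i) * c \<alpha>)"
  note ps = power_series_curve_holomorphic[OF \<rho>(1) summable, where a=a]
  show ?thesis
  proof (rule extendable_at_radius[OF ps(1)[folded H_def] _ \<rho>(1)])
    fix y assume y: "y \<in> ball a \<rho>"
    have "((\<lambda>\<alpha>. (\<Prod>i\<in>UNIV. (cvec y $ i - complex_of_real (a $ i)) ^ \<alpha> i) * c \<alpha>) has_sum H (cvec y)) UNIV"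
      unfolding H_def using y by (intro ps(2)) simp
    then have "((\<lambda>\<alpha>. (\<Prod>i\<in>UNIV. (y $ i - a $ i) ^ \<alpha> i) *\<^sub>R c \<alpha>) has_sum H (cvec y)) UNIV"
      by (simp add: scaleR_conv_of_real)
    then show "g y = H (cvec y)"
      using c[of y] y \<rho>(2) has_sum_unique by fastforce
  qed
qed

lemma line_holomorphic:
  assumes "curve_holomorphic U H" "open U"
  shows "open {z. p + z *s q \<in> U}" "(\<lambda>z. H (p + z *s q)) holomorphic_on {z. p + z *s q \<in> U}"
proof -
  have "continuous_on UNIV (\<lambda>z. p + z *s q)"
    unfolding vector_scalar_mult_def by (intro continuous_intros)
  then show op: "open {z. p + z *s q \<in> U}"
    using open_vimage[OF assms(2)] by (simp add: vimage_def)
  show "(\<lambda>z. H (p + z *s q)) holomorphic_on {z. p + z *s q \<in> U}"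
    by (rule curve_holomorphicD[OF assms(1) op]) (auto intro!: holomorphic_intros)
qed

lemma connected_line_ball: "connected {z. p + z *s q \<in> ball w r}" for q :: "complex ^ 'n"
proof (rule convex_connected, rule convexI)
  fix x y u v assume *: "x \<in> {z. p + z *s q \<in> ball w r}" "y \<in> {z. p + z *s q \<in> ball w r}"
    "0 \<le> u" "0 \<le> v" "u + v = (1::real)"
  have "p + (u *\<^sub>R x + v *\<^sub>R y) *s q = (u + v) *\<^sub>R p + (u *\<^sub>R x + v *\<^sub>R y) *s q"
    using * by simp
  also have "\<dots> = u *\<^sub>R (p + x *s q) + v *\<^sub>R (p + y *s q)"
    by (simp add: vec_eq_iff algebra_simps)
  also have "\<dots> \<in> ball w r"
    using * by (intro convexD convex_ball) auto
  finally show "u *\<^sub>R x + v *\<^sub>R y \<in> {z. p + z *s q \<in> ball w r}"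
    by simp
qed

lemma cvec_line: "cvec b + complex_of_real t *s cvec v = cvec (b + t *\<^sub>R v)"
  by (simp add: vec_eq_iff)

text \<open>The identity theorem, reduced to one complex variable along the line through \<open>b\<close> and \<open>y\<close>.\<close>

lemma curve_holomorphic_vanishing_spreads:
  assumes H: "curve_holomorphic (ball (cvec a) r) H"
    and b: "b \<in> ball a r" "eventually (\<lambda>y. H (cvec y) = 0) (nhds b)" and y: "y \<in> ball a r"
  shows "H (cvec y) = 0"
proof -
  let ?v = "cvec (y - b)"
  let ?D = "{z. cvec b + z *s ?v \<in> ball (cvec a) r}"
  note G = line_holomorphic[OF H open_ball, of "cvec b" ?v]
  have line: "cvec b + complex_of_real t *s ?v = cvec (b + t *\<^sub>R (y - b))" for t
    by (rule cvec_line)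
  have ev: "eventually (\<lambda>t. H (cvec (b + t *\<^sub>R (y - b))) = 0) (nhds (0::real))"
  proof -
    have "((\<lambda>t. b + t *\<^sub>R (y - b)) \<longlongrightarrow> b + 0 *\<^sub>R (y - b)) (nhds (0::real))"
      by (intro tendsto_intros filterlim_ident)
    then show ?thesis
      using filterlim_iff[THEN iffD1, rule_format, of _ _ _ "\<lambda>y. H (cvec y) = 0"] b(2) by simp
  qed
  then obtain e where e: "0 < e" "\<And>t. \<bar>t\<bar> < e \<Longrightarrow> H (cvec (b + t *\<^sub>R (y - b))) = 0"
    unfolding eventually_nhds_metric by (auto simp: dist_norm)
  have "0 \<in> ?D" "1 \<in> ?D"
    using b(1) y line[of 0] line[of 1] by auto
  have "(\<lambda>z. H (cvec b + z *s ?v)) 1 = 0"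
  proof (rule analytic_continuation[OF G(2) G(1) connected_line_ball])
    show "0 islimpt ({z. \<exists>t. z = complex_of_real t \<and> \<bar>t\<bar> < e} \<inter> ?D)"
      unfolding islimpt_approachable
    proof (intro allI impI)
      fix d :: real assume "d > 0"
      obtain d' where d': "d' > 0" "ball 0 d' \<subseteq> ?D"
        using G(1) \<open>0 \<in> ?D\<close> open_contains_ball by blast
      define t where "t = min d (min d' e) / 2"
      have t: "0 < t" "t < d" "t < d'" "t < e"
        using \<open>d > 0\<close> d'(1) e(1) by (auto simp: t_def)
      have "complex_of_real t \<in> ?D"
        using t by (intro subsetD[OF d'(2)]) simp
      then show "\<exists>x'\<in>{z. \<exists>t. z = complex_of_real t \<and> \<bar>t\<bar> < e} \<inter> ?D. x' \<noteq> 0 \<and> dist x' 0 < d"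
        using t by (intro bexI[of _ "complex_of_real t"]) auto
    qed
    show "H (cvec b + z *s ?v) = 0" if "z \<in> {z. \<exists>t. z = complex_of_real t \<and> \<bar>t\<bar> < e} \<inter> ?D" for z
      using that e(2) line by auto
  qed (use \<open>0 \<in> ?D\<close> \<open>1 \<in> ?D\<close> in auto)
  then show ?thesis
    using line[of 1] by simp
qed

section \<open>Sublevel estimates in several variables\<close>

text \<open>A one-dimensional estimate on every segment in direction \<open>v\<close> is integrated to an estimate in full
  dimension. By translation invariance the measure of \<open>E\<close> is its average over the translates by \<open>- t v\<close>
  with \<open>t\<close> in \<open>{0..\<delta>}\<close>, and Tonelli exchanges the integrals over \<open>t\<close> and over the base point. The ball of
  twice the radius contains all these translates.\<close>

lemma sublevel_estimate_of_local_cover: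
  fixes v a :: "'a::euclidean_space"
  assumes E: "E \<in> sets borel" "E \<subseteq> ball a \<rho>" and \<delta>: "0 < \<delta>" "\<delta> * norm v \<le> \<rho>" and K: "0 \<le> K"
    and cover: "\<And>x. x \<in> ball a (2 * \<rho>) \<Longrightarrow>
      \<exists>B \<in> sets lborel. {t \<in> {0..\<delta>}. x + t *\<^sub>R v \<in> E} \<subseteq> B \<and> emeasure lborel B \<le> ennreal K"
  shows "emeasure lborel E \<le> ennreal (K * measure lborel (ball a (2 * \<rho>)) / \<delta>)"
proof -
  let ?B = "ball a (2 * \<rho>)"
  have [measurable]: "E \<in> sets borel" "?B \<in> sets borel"
    using E by auto
  let ?F = "\<lambda>(s, x). indicator {0..\<delta>} s * (indicator E (x + s *\<^sub>R v) * indicator ?B x) :: ennreal"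
  have meas: "?F \<in> borel_measurable (lborel \<Otimes>\<^sub>M lborel)"
    by measurable
  have shift: "emeasure lborel E = (\<integral>\<^sup>+x. indicator E (x + s *\<^sub>R v) * indicator ?B x \<partial>lborel)"
    if s: "s \<in> {0..\<delta>}" for s
  proof -
    have "emeasure lborel E = (\<integral>\<^sup>+x. indicator E x \<partial>distr lborel borel ((+) (s *\<^sub>R v)))"
      by (simp add: lborel_distr_plus)
    also have "\<dots> = (\<integral>\<^sup>+x. indicator E (x + s *\<^sub>R v) \<partial>lborel)"
      by (subst nn_integral_distr) (auto simp: add.commute)
    also have "\<dots> = (\<integral>\<^sup>+x. indicator E (x + s *\<^sub>R v) * indicator ?B x \<partial>lborel)"
    proof (rule nn_integral_cong)
      fix x
      have "x \<in> ?B" if "x + s *\<^sub>R v \<in> E"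
      proof -
        have "norm (s *\<^sub>R v) \<le> \<rho>"
          using s \<delta> mult_right_mono[of s \<delta> "norm v"] by simp
        moreover have "dist a x \<le> dist a (x + s *\<^sub>R v) + norm (s *\<^sub>R v)"
          using dist_triangle[of a x "x + s *\<^sub>R v"] by (simp add: dist_norm)
        moreover have "dist a (x + s *\<^sub>R v) < \<rho>"
          using that E(2) by auto
        ultimately show ?thesis by simp
      qed
      then show "indicator E (x + s *\<^sub>R v) = indicator E (x + s *\<^sub>R v) * (indicator ?B x :: ennreal)"
        by (auto simp: indicator_def)
    qed
    finally show ?thesis .
  qed
  have "emeasure lborel E * ennreal \<delta> = (\<integral>\<^sup>+s. emeasure lborel E * indicator {0..\<delta>} s \<partial>lborel)"
    using \<delta> by (simp add: nn_integral_cmult_indicator)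
  also have "\<dots> = (\<integral>\<^sup>+s. \<integral>\<^sup>+x. ?F (s, x) \<partial>lborel \<partial>lborel)"
    by (intro nn_integral_cong) (auto simp: shift indicator_def)
  also have "\<dots> = (\<integral>\<^sup>+x. \<integral>\<^sup>+s. ?F (s, x) \<partial>lborel \<partial>lborel)"
    using lborel_pair.Fubini'[of "\<lambda>s x. ?F (s, x)"] meas by simp
  also have "\<dots> \<le> (\<integral>\<^sup>+x. ennreal K * indicator ?B x \<partial>lborel)"
  proof (rule nn_integral_mono)
    fix x :: 'a
    show "(\<integral>\<^sup>+s. ?F (s, x) \<partial>lborel) \<le> ennreal K * indicator ?B x"
    proof (cases "x \<in> ?B")
      case True
      then obtain B where B: "B \<in> sets lborel" "{t \<in> {0..\<delta>}. x + t *\<^sub>R v \<in> E} \<subseteq> B" "emeasure lborel B \<le> ennreal K"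
        using cover by blast
      have "(\<integral>\<^sup>+s. ?F (s, x) \<partial>lborel) \<le> (\<integral>\<^sup>+s. indicator B s \<partial>lborel)"
        by (intro nn_integral_mono) (use B(2) in \<open>auto simp: indicator_def\<close>)
      then show ?thesis
        using B(1,3) True by simp
    qed simp
  qed
  also have "\<dots> = ennreal K * emeasure lborel ?B"
    by (simp add: nn_integral_cmult_indicator)
  also have "\<dots> = ennreal (K * measure lborel ?B)"
    using K emeasure_lborel_ball_finite[of a "2 * \<rho>"]
    by (subst emeasure_eq_ennreal_measure) (auto simp: ennreal_mult)
  finally have "emeasure lborel E * ennreal \<delta> \<le> ennreal (K * measure lborel ?B)" .
  moreover have "emeasure lborel E < \<infinity>"
    using emeasure_mono[OF E(2), of lborel] emeasure_lborel_ball_finite[of a \<rho>]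
    by (auto simp: le_less_trans)
  then obtain e where "emeasure lborel E = ennreal e" "0 \<le> e"
    by (cases "emeasure lborel E") auto
  ultimately show ?thesis
    using \<delta>(1) K by (simp add: ennreal_mult'[symmetric] ennreal_le_iff field_simps)
qed

text \<open>Since \<open>H\<close> does not vanish at the real point \<open>y\<close>, some derivative of \<open>H\<close> at \<open>a\<close> in the direction
  \<open>v = y - a\<close> is nonzero, say of order \<open>k\<close> and with value \<open>w\<close>. By the Cauchy inequality this derivative
  stays close to \<open>w\<close> at all points near \<open>a\<close>. The one-dimensional sublevel estimate then holds with the
  same constant on all short segments in direction \<open>v\<close>.\<close>

lemma curve_holomorphic_sublevel_estimate:
  fixes a :: "real ^ 'l"
  assumes H: "curve_holomorphic (ball (cvec a) r) H" and r: "0 < r"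
    and y: "y \<in> ball a r" "H (cvec y) \<noteq> 0"
  obtains \<rho> k c C where "0 < \<rho>" "\<rho> \<le> r" "0 < c" "c \<le> 1" "0 \<le> C"
    "\<And>\<eta>. 0 < \<eta> \<Longrightarrow> emeasure lborel {x \<in> ball a \<rho>. cmod (H (cvec x)) < c * \<eta> ^ k} \<le> ennreal (C * \<eta>)"
proof -
  define v where "v = y - a"
  define G where "G x z = H (cvec x + z *s cvec v)" for x z
  have "norm v < r"
    using y(1) by (simp add: v_def dist_norm norm_minus_commute)
  let ?D = "{z. cvec a + z *s cvec v \<in> ball (cvec a) r}"
  note Ga = line_holomorphic[OF H open_ball, of "cvec a" "cvec v", folded G_def]
  have "\<exists>k. (deriv ^^ k) (G a) 0 \<noteq> 0"
  proof (rule ccontr)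
    assume "\<not> ?thesis"
    then have "G a 1 = 0"
      by (intro holomorphic_fun_eq_0_on_connected[OF Ga(2) Ga(1) connected_line_ball, of 0])
         (use r \<open>norm v < r\<close> in \<open>auto simp: dist_norm\<close>)
    moreover have "G a 1 = H (cvec y)"
      using cvec_line[of a 1 v] by (simp add: G_def v_def)
    ultimately show False
      using y(2) by simp
  qed
  then obtain k where k: "(deriv ^^ k) (G a) 0 \<noteq> 0" by blast
  define w where "w = (deriv ^^ k) (G a) 0"
  have w: "w \<noteq> 0" using k by (simp add: w_def)
  \<comment> \<open>Half the radius gives a compact ball for uniform continuity; \<open>2 * \<tau>\<close> is a radius for the parameter
    that keeps all lines with base point near \<open>a\<close> inside it, and \<open>\<tau>\<close> is the radius of the Cauchy inequality.\<close>
  define r' where "r' = r / 2"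
  define \<tau> where "\<tau> = r' / (4 * (norm v + 1))"
  have nv: "0 < norm v + 1"
    by (simp add: add_nonneg_pos)
  have \<tau>: "0 < \<tau>" "2 * \<tau> * norm v \<le> r' / 2"
    using r nv by (auto simp: \<tau>_def r'_def field_simps)
  have mem: "cvec x + z *s cvec v \<in> cball (cvec a) r'" if "dist a x \<le> r' / 2" "cmod z \<le> 2 * \<tau>" for x z
  proof -
    have "norm (z *s cvec v) \<le> r' / 2"
      using that(2) \<tau>(2) mult_right_mono[of "cmod z" "2 * \<tau>" "norm v"] by (simp add: norm_mult_vec)
    moreover have "dist (cvec a) (cvec x + z *s cvec v) \<le> dist (cvec a) (cvec x) + norm (z *s cvec v)"
      using dist_triangle[of "cvec a" "cvec x + z *s cvec v" "cvec x"] by (simp add: dist_norm)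
    ultimately show ?thesis
      using that(1) by simp
  qed
  have hol: "G x holomorphic_on ball 0 (2 * \<tau>)" if "dist a x \<le> r' / 2" for x
  proof -
    have "ball 0 (2 * \<tau>) \<subseteq> {z. cvec x + z *s cvec v \<in> ball (cvec a) r}"
    proof
      fix z :: complex assume "z \<in> ball 0 (2 * \<tau>)"
      then have "cvec x + z *s cvec v \<in> cball (cvec a) r'"
        by (intro mem that) auto
      then show "z \<in> {z. cvec x + z *s cvec v \<in> ball (cvec a) r}"
        using r by (auto simp: r'_def)
    qed
    then show ?thesis
      using line_holomorphic(2)[OF H open_ball, of "cvec x" "cvec v", folded G_def] holomorphic_on_subset by blast
  qed
  have r': "0 < r'" "r' < r" using r by (auto simp: r'_def)
  define \<epsilon> where "\<epsilon> = cmod w / 4 * \<tau> ^ k / fact k"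
  have \<epsilon>: "0 < \<epsilon>" using w \<tau> by (simp add: \<epsilon>_def)
  have "uniformly_continuous_on (cball (cvec a) r') H"
  proof (rule compact_uniformly_continuous)
    show "continuous_on (cball (cvec a) r') H"
      using curve_holomorphic_imp_continuous_on[OF H] r' by (rule_tac continuous_on_subset) auto
  qed auto
  then obtain d where d: "0 < d" "\<And>p q. p \<in> cball (cvec a) r' \<Longrightarrow> q \<in> cball (cvec a) r' \<Longrightarrow> dist p q < d \<Longrightarrow> dist (H p) (H q) < \<epsilon>"
    using \<epsilon> unfolding uniformly_continuous_on_def by metis
  have "isCont ((deriv ^^ k) (G a)) 0"
  proof -
    have "(deriv ^^ k) (G a) holomorphic_on ball 0 (2 * \<tau>)"
      using r' by (intro holomorphic_higher_deriv hol) auto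
    then have "continuous_on (ball 0 (2 * \<tau>)) ((deriv ^^ k) (G a))"
      by (rule holomorphic_on_imp_continuous_on)
    then show ?thesis
      using \<tau>(1) by (simp add: continuous_on_eq_continuous_at)
  qed
  then obtain \<delta>0 where \<delta>0: "0 < \<delta>0" "\<And>z. cmod z < \<delta>0 \<Longrightarrow> cmod ((deriv ^^ k) (G a) z - w) < cmod w / 4"
    using w unfolding continuous_at_eps_delta w_def[symmetric] dist_norm
    by (metis diff_zero zero_less_divide_iff zero_less_norm_iff zero_less_numeral)
  define \<rho> where "\<rho> = min (r' / 4) (d / 2)"
  have \<rho>: "0 < \<rho>" "2 * \<rho> \<le> r' / 2" "2 * \<rho> \<le> d" "\<rho> \<le> r"
    using r' d by (auto simp: \<rho>_def)
  define \<delta> where "\<delta> = min (min (\<delta>0 / 2) (\<tau> / 2)) (\<rho> / (norm v + 1))"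
  have \<delta>: "0 < \<delta>" "\<delta> < \<delta>0" "\<delta> < \<tau>" "\<delta> * norm v \<le> \<rho>"
  proof -
    show "0 < \<delta>" "\<delta> < \<delta>0" "\<delta> < \<tau>"
      using \<delta>0 \<tau> \<rho> nv by (auto simp: \<delta>_def)
    have "\<delta> * norm v \<le> \<rho> / (norm v + 1) * (norm v + 1)"
      using \<rho> nv by (intro mult_mono) (auto simp: \<delta>_def)
    then show "\<delta> * norm v \<le> \<rho>"
      using nv by simp
  qed
  have close: "cmod ((deriv ^^ k) (G x) (complex_of_real t) - w) \<le> cmod w / 2"
    if x: "dist a x < 2 * \<rho>" and t: "t \<in> {0..\<delta>}" for x t
  proof -
    let ?t = "complex_of_real t"
    have sub: "cball ?t \<tau> \<subseteq> ball 0 (2 * \<tau>)"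
    proof
      fix z assume "z \<in> cball ?t \<tau>"
      then have "cmod (z - ?t) \<le> \<tau>" by (simp add: dist_norm norm_minus_commute)
      then have "cmod z \<le> \<tau> + t"
        using norm_triangle_sub[of z ?t] t by simp
      then show "z \<in> ball 0 (2 * \<tau>)"
        using t \<delta> by simp
    qed
    have hx: "G x holomorphic_on ball 0 (2 * \<tau>)" and ha: "G a holomorphic_on ball 0 (2 * \<tau>)"
      using x \<rho> r' by (auto intro!: hol)
    have hd: "(\<lambda>z. G x z - G a z) holomorphic_on ball 0 (2 * \<tau>)"
      by (intro holomorphic_intros hx ha)
    have "cmod ((deriv ^^ k) (\<lambda>z. G x z - G a z) ?t) \<le> fact k * \<epsilon> / \<tau> ^ k"
    proof (rule Cauchy_inequality)
      show "(\<lambda>z. G x z - G a z) holomorphic_on ball ?t \<tau>"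
        by (rule holomorphic_on_subset[OF hd]) (use sub in auto)
      show "continuous_on (cball ?t \<tau>) (\<lambda>z. G x z - G a z)"
        by (rule continuous_on_subset[OF holomorphic_on_imp_continuous_on[OF hd] sub])
      show "cmod (G x z - G a z) \<le> \<epsilon>" if "cmod (?t - z) = \<tau>" for z
      proof -
        have "z \<in> cball ?t \<tau>" using that by (simp add: dist_norm)
        then have "cmod z \<le> 2 * \<tau>" using sub by fastforce
        moreover have "dist (cvec x + z *s cvec v) (cvec a + z *s cvec v) = dist (cvec a) (cvec x)"
          by (simp add: dist_norm norm_minus_commute del: dist_cvec)
        then have "dist (cvec x + z *s cvec v) (cvec a + z *s cvec v) < d"
          using x \<rho> by simp
        ultimately have "dist (G x z) (G a z) < \<epsilon>"
          unfolding G_def using x \<rho> r' by (intro d(2) mem) auto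
        then show ?thesis by (simp add: dist_norm)
      qed
    qed (use \<tau> in simp)
    also have "fact k * \<epsilon> / \<tau> ^ k = cmod w / 4"
      using \<tau> by (simp add: \<epsilon>_def)
    also have "(deriv ^^ k) (\<lambda>z. G x z - G a z) ?t = (deriv ^^ k) (G x) ?t - (deriv ^^ k) (G a) ?t"
      using t \<delta> \<tau> by (intro higher_deriv_diff[OF hx ha]) auto
    finally have "cmod ((deriv ^^ k) (G x) ?t - (deriv ^^ k) (G a) ?t) \<le> cmod w / 4" .
    moreover have "cmod ((deriv ^^ k) (G a) ?t - w) < cmod w / 4"
      using t \<delta> by (intro \<delta>0(2)) auto
    ultimately show ?thesis
      using norm_triangle_ineq[of "(deriv ^^ k) (G x) ?t - (deriv ^^ k) (G a) ?t" "(deriv ^^ k) (G a) ?t - w"]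
      by simp
  qed
  \<comment> \<open>The factor \<open>\<omega>\<close> rotates and scales \<open>w\<close> to 2, so that real parts of \<open>k\<close>-th derivatives are at least 1.\<close>
  define \<omega> where "\<omega> = 2 * cnj w / complex_of_real ((cmod w)\<^sup>2)"
  have \<omega>w: "\<omega> * w = 2"
    unfolding \<omega>_def complex_norm_square using w by simp
  have \<omega>n: "cmod \<omega> = 2 / cmod w"
    using w by (simp add: \<omega>_def norm_divide norm_mult power2_eq_square)
  define c where "c = min 1 (cmod w / 2)"
  define M where "M = 4 * (2 ^ k - 1 :: real)"
  have M: "0 \<le> M" by (simp add: M_def)
  show thesis
  proof (rule that[of \<rho> c "M * measure lborel (ball a (2 * \<rho>)) / \<delta>" k])
    fix \<eta> :: real assume \<eta>: "0 < \<eta>"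
    let ?E = "{x \<in> ball a \<rho>. cmod (H (cvec x)) < c * \<eta> ^ k}"
    have "open ?E"
    proof -
      have "continuous_on (ball a \<rho>) (\<lambda>x. H (cvec x))"
        by (rule continuous_on_compose2[OF curve_holomorphic_imp_continuous_on[OF H] continuous_on_cvec])
           (use \<rho> in auto)
      then have "continuous_on (ball a \<rho>) (\<lambda>x. cmod (H (cvec x)))"
        by (rule continuous_on_norm)
      from continuous_open_preimage[OF this open_ball open_lessThan, of "c * \<eta> ^ k"]
      show ?thesis by (simp add: vimage_def Int_def conj_commute)
    qed
    have "emeasure lborel ?E \<le> ennreal (M * \<eta> * measure lborel (ball a (2 * \<rho>)) / \<delta>)"
    proof (rule sublevel_estimate_of_local_cover[OF _ _ \<delta>(1,4)])
      fix x assume "x \<in> ball a (2 * \<rho>)"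
      then have x: "dist a x < 2 * \<rho>" by simp
      define u where "u j t = Re (\<omega> * (deriv ^^ j) (G x) (complex_of_real t))" for j t
      have hx: "G x holomorphic_on ball 0 (2 * \<tau>)"
        using x \<rho> by (intro hol) auto
      have "\<exists>B\<in>sets lborel. {t \<in> {0..\<delta>}. \<bar>u 0 t\<bar> < \<eta> ^ k} \<subseteq> B \<and> emeasure lborel B \<le> ennreal (4 * (2 ^ k - 1) * \<eta>)"
      proof (rule sublevel_interval_cover)
        show "(u j has_real_derivative u (Suc j) t) (at t)" if "t \<in> {0..\<delta>}" for j t
        proof -
          have "((deriv ^^ j) (G x) has_field_derivative (deriv ^^ Suc j) (G x) (complex_of_real t)) (at (complex_of_real t))"
            using that \<delta> \<tau> by (intro has_field_derivative_higher_deriv[OF hx]) auto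
          then have "((\<lambda>z. \<omega> * (deriv ^^ j) (G x) z) has_field_derivative
              \<omega> * (deriv ^^ Suc j) (G x) (complex_of_real t)) (at (complex_of_real t))"
            by (rule DERIV_cmult)
          then have "((\<lambda>t. \<omega> * (deriv ^^ j) (G x) (complex_of_real t)) has_vector_derivative
              \<omega> * (deriv ^^ Suc j) (G x) (complex_of_real t)) (at t)"
            by (rule has_vector_derivative_real_field)
          then show ?thesis
            unfolding u_def has_real_derivative_iff_has_vector_derivative
            by (rule bounded_linear.has_vector_derivative[OF bounded_linear_Re])
        qed
        show "1 \<le> u k t" if "t \<in> {0..\<delta>}" for t
        proof -
          let ?d = "(deriv ^^ k) (G x) (complex_of_real t) - w"
          have "cmod (\<omega> * ?d) \<le> 2 / cmod w * (cmod w / 2)"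
            unfolding norm_mult \<omega>n using close[OF x that] by (intro mult_left_mono) auto
          then have "cmod (\<omega> * ?d) \<le> 1"
            using w by simp
          then have "\<bar>Re (\<omega> * ?d)\<bar> \<le> 1"
            using abs_Re_le_cmod order_trans by blast
          moreover have "u k t = Re (\<omega> * w) + Re (\<omega> * ?d)"
            by (simp add: u_def ring_distribs)
          ultimately show ?thesis
            by (simp add: \<omega>w)
        qed
      qed (use \<eta> in \<open>auto simp: is_interval_cc\<close>)
      moreover have "{t \<in> {0..\<delta>}. x + t *\<^sub>R v \<in> ?E} \<subseteq> {t \<in> {0..\<delta>}. \<bar>u 0 t\<bar> < \<eta> ^ k}"
      proof safe
        fix t assume "x + t *\<^sub>R v \<in> ball a \<rho>" "cmod (H (cvec (x + t *\<^sub>R v))) < c * \<eta> ^ k"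
        then have "cmod (G x (complex_of_real t)) < c * \<eta> ^ k"
          by (simp add: G_def cvec_line)
        also have "\<dots> \<le> cmod w / 2 * \<eta> ^ k"
          using \<eta> by (intro mult_right_mono) (auto simp: c_def)
        finally have "cmod (G x (complex_of_real t)) < cmod w / 2 * \<eta> ^ k" .
        then have "2 / cmod w * cmod (G x (complex_of_real t)) < \<eta> ^ k"
          using w by (simp add: field_simps)
        moreover have "\<bar>u 0 t\<bar> \<le> cmod (\<omega> * G x (complex_of_real t))"
          unfolding u_def funpow_0 by (rule abs_Re_le_cmod)
        ultimately show "\<bar>u 0 t\<bar> < \<eta> ^ k"
          by (simp add: norm_mult \<omega>n)
      qed
      ultimately show "\<exists>B\<in>sets lborel. {t \<in> {0..\<delta>}. x + t *\<^sub>R v \<in> ?E} \<subseteq> B \<and> emeasure lborel B \<le> ennreal (M * \<eta>)"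
        unfolding M_def by (meson order_trans)
    qed (use \<open>open ?E\<close> M \<eta> in auto)
    then show "emeasure lborel ?E \<le> ennreal (M * measure lborel (ball a (2 * \<rho>)) / \<delta> * \<eta>)"
      by (simp add: mult_ac)
  qed (use \<rho> w M \<delta> in \<open>auto simp: c_def\<close>)
qed

section \<open>Analytic functions on the manifold\<close>

text \<open>Complex-valued functions with holomorphic extensions in all charts of the atlas. For the empty
  atlas of a discrete space the second condition is vacuous and every function is analytic.\<close>

definition analytic_function :: "('x::topological_space, 'l::finite) chart set \<Rightarrow> ('x \<Rightarrow> complex) \<Rightarrow> bool" where
  "analytic_function \<A> h \<longleftrightarrow> continuous_on UNIV h \<and>
     (\<forall>(S, \<phi>)\<in>\<A>. \<forall>x\<in>S. extendable_at (\<lambda>y. h (inv_into S \<phi> y)) (\<phi> x))"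

lemma analytic_functionI:
  assumes "continuous_on UNIV h"
    and "\<And>S \<phi> x. (S, \<phi>) \<in> \<A> \<Longrightarrow> x \<in> S \<Longrightarrow> extendable_at (\<lambda>y. h (inv_into S \<phi> y)) (\<phi> x)"
  shows "analytic_function \<A> h"
  using assms unfolding analytic_function_def by auto

lemma analytic_functionD:
  assumes "analytic_function \<A> h"
  shows "continuous_on UNIV h"
    and "(S, \<phi>) \<in> \<A> \<Longrightarrow> x \<in> S \<Longrightarrow> extendable_at (\<lambda>y. h (inv_into S \<phi> y)) (\<phi> x)"
  using assms unfolding analytic_function_def by auto

lemma analytic_function_const: "analytic_function \<A> (\<lambda>_. c)"
  by (intro analytic_functionI extendable_at_const) auto

lemma analytic_function_add:
  "analytic_function \<A> g \<Longrightarrow> analytic_function \<A> h \<Longrightarrow> analytic_function \<A> (\<lambda>x. g x + h x)"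
  unfolding analytic_function_def by (auto intro!: extendable_at_add continuous_on_add)

lemma analytic_function_mult:
  "analytic_function \<A> g \<Longrightarrow> analytic_function \<A> h \<Longrightarrow> analytic_function \<A> (\<lambda>x. g x * h x)"
  unfolding analytic_function_def by (auto intro!: extendable_at_mult continuous_on_mult)

lemma analytic_function_sum:
  "(\<And>i. i \<in> I \<Longrightarrow> analytic_function \<A> (h i)) \<Longrightarrow> analytic_function \<A> (\<lambda>x. \<Sum>i\<in>I. h i x)"
  by (induction I rule: infinite_finite_induct) (auto intro: analytic_function_const analytic_function_add)

lemma analytic_function_prod:
  "(\<And>i. i \<in> I \<Longrightarrow> analytic_function \<A> (h i)) \<Longrightarrow> analytic_function \<A> (\<lambda>x. \<Prod>i\<in>I. h i x)"
  by (induction I rule: infinite_finite_induct) (auto intro: analytic_function_const analytic_function_mult)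

lemma analytic_function_matrix_mult:
  assumes "\<And>i j. analytic_function \<A> (\<lambda>x. F x $ i $ j)" "\<And>i j. analytic_function \<A> (\<lambda>x. G x $ i $ j)"
  shows "analytic_function \<A> (\<lambda>x. (F x ** G x) $ i $ j)"
  unfolding matrix_matrix_mult_def vec_lambda_beta
  by (intro analytic_function_sum analytic_function_mult assms)

lemma analytic_function_det:
  assumes "\<And>i j. analytic_function \<A> (\<lambda>x. F x $ i $ j)"
  shows "analytic_function \<A> (\<lambda>x. det (F x))"
  unfolding det_def
  by (intro analytic_function_sum analytic_function_mult analytic_function_prod analytic_function_const assms)

lemma topological_chartD:
  assumes "topological_chart (S, \<phi>)"
  shows "open S" "open (\<phi> ` S)" "continuous_on S \<phi>" "inj_on \<phi> S" "continuous_on (\<phi> ` S) (inv_into S \<phi>)"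
proof -
  obtain \<psi> where \<psi>: "homeomorphism S (\<phi> ` S) \<phi> \<psi>"
    using assms unfolding topological_chart_def by auto
  show "open S" "open (\<phi> ` S)"
    using assms unfolding topological_chart_def by auto
  show "continuous_on S \<phi>"
    by (rule homeomorphism_cont1[OF \<psi>])
  show inj: "inj_on \<phi> S"
    by (rule inj_on_inverseI[of _ \<psi>]) (use \<psi> homeomorphism_apply1 in blast)
  show "continuous_on (\<phi> ` S) (inv_into S \<phi>)"
    by (rule continuous_on_eq[OF homeomorphism_cont2[OF \<psi>]])
       (use inj homeomorphism_apply1[OF \<psi>] in auto)
qed

lemma open_if_open_singletons:
  assumes "\<And>x::'x::topological_space. open {x}"
  shows "open (T :: 'x set)"
  using open_UN[of T "\<lambda>x. {x}"] assms by simp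

lemma real_analytic_atlas_cases:
  assumes "real_analytic_atlas (\<A> :: ('x::topological_space, 'l::finite) chart set)"
  obtains "\<And>x::'x. \<exists>S \<phi>. (S, \<phi>) \<in> \<A> \<and> x \<in> S" "\<And>S \<phi>. (S, \<phi>) \<in> \<A> \<Longrightarrow> topological_chart (S, \<phi>)"
      "\<And>S \<phi>. (S, \<phi>) \<in> \<A> \<Longrightarrow> analytic_chart \<A> (S, \<phi>)"
  | "\<A> = {}" "\<And>x::'x. open {x}"
proof (cases "\<A> = {} \<and> (\<forall>x::'x. open {x})")
  case False
  then have *: "(\<Union>(S, \<phi>)\<in>\<A>. S) = UNIV" "\<And>c. c \<in> \<A> \<Longrightarrow> topological_chart c"
      "\<And>c c'. c \<in> \<A> \<Longrightarrow> c' \<in> \<A> \<Longrightarrow> analytic_transition c c'"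
    using assms unfolding real_analytic_atlas_def by auto
  show ?thesis
  proof (rule that(1))
    show "\<exists>S \<phi>. (S, \<phi>) \<in> \<A> \<and> x \<in> S" for x
    proof -
      have "x \<in> (\<Union>(S, \<phi>)\<in>\<A>. S)" using *(1) by simp
      then show ?thesis by auto
    qed
  qed (use *(2,3) in \<open>auto simp: analytic_chart_def\<close>)
qed (use that(2) in auto)

lemma analytic_vector_map_imp_analytic_function:
  fixes \<A> :: "('x::t2_space, 'l::finite) chart set"
  assumes atlas: "real_analytic_atlas \<A>" and g: "analytic_vector_map \<A> g" and L: "bounded_linear L"
  shows "analytic_function \<A> (\<lambda>x. L (g x))"
proof (rule analytic_functionI)
  show ext: "extendable_at (\<lambda>y. L (g (inv_into S \<phi> y))) (\<phi> x)" if "(S, \<phi>) \<in> \<A>" "x \<in> S" for S \<phi> x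
  proof -
    have "real_analytic_at (\<lambda>y. g (inv_into S \<phi> y)) (\<phi> x)"
    proof -
      have "real_analytic_on (g \<circ> inv_into S \<phi>) (\<phi> ` S)"
        using g that(1) unfolding analytic_vector_map_def by auto
      then show ?thesis
        using that(2) unfolding real_analytic_on_def o_def by auto
    qed
    then show ?thesis
      by (rule real_analytic_at_imp_extendable_at[OF real_analytic_at_bounded_linear[OF _ L]])
  qed
  show "continuous_on UNIV (\<lambda>x. L (g x))"
    using atlas
  proof (cases rule: real_analytic_atlas_cases)
    case 1
    have "isCont (\<lambda>x. L (g x)) x" for x
    proof -
      obtain S \<phi> where S: "(S, \<phi>) \<in> \<A>" "x \<in> S"
        using 1 by blast
      note ch = topological_chartD[OF 1(2)[OF S(1)]]
      have "isCont \<phi> x"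
        using ch S by (simp add: continuous_on_eq_continuous_at)
      then have "isCont (\<lambda>z. L (g (inv_into S \<phi> (\<phi> z)))) x"
        using extendable_at_imp_isCont[OF ext[OF S]] by (rule isCont_o2)
      moreover have "\<forall>\<^sub>F z in nhds x. L (g (inv_into S \<phi> (\<phi> z))) = L (g z)"
        by (rule eventually_mono[OF eventually_nhds_in_open[OF ch(1) S(2)]]) (simp add: ch(4))
      ultimately show ?thesis
        using isCont_cong by fastforce
    qed
    then show ?thesis
      by (simp add: continuous_on_eq_continuous_at)
  next
    case 2
    then show ?thesis
      by (simp add: continuous_on_open_vimage open_if_open_singletons[OF 2(2)])
  qed
qed

text \<open>Near the given point, the coordinate expression of \<open>h \<circ> f\<close> is that of \<open>h\<close> in a chart at the image
  point, composed with the coordinate expression of \<open>f\<close>.\<close>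

lemma analytic_function_compose_self_map:
  fixes \<A> :: "('x::t2_space, 'l::finite) chart set"
  assumes atlas: "real_analytic_atlas \<A>" and f: "analytic_self_map \<A> f" and h: "analytic_function \<A> h"
  shows "analytic_function \<A> (\<lambda>x. h (f x))"
proof (rule analytic_functionI)
  have cf: "continuous_on UNIV f"
    using f unfolding analytic_self_map_def by blast
  then show "continuous_on UNIV (\<lambda>x. h (f x))"
    using continuous_on_compose2[OF analytic_functionD(1)[OF h] cf] by simp
  fix S \<phi> x assume S: "(S, \<phi>) \<in> \<A>" "x \<in> S"
  show "extendable_at (\<lambda>y. h (f (inv_into S \<phi> y))) (\<phi> x)"
    using atlas
  proof (cases rule: real_analytic_atlas_cases)
    case 1
    obtain T \<psi> where T: "(T, \<psi>) \<in> \<A>" "f x \<in> T"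
      using 1 by blast
    note S' = topological_chartD[OF 1(2)[OF S(1)]]
    note T' = topological_chartD[OF 1(2)[OF T(1)]]
    let ?g = "\<lambda>y. \<psi> (f (inv_into S \<phi> y))"
    have "real_analytic_at ?g (\<phi> x)"
    proof -
      have "\<forall>(S, \<phi>)\<in>\<A>. \<forall>(T, \<psi>)\<in>\<A>. real_analytic_on (\<psi> \<circ> f \<circ> inv_into S \<phi>) (\<phi> ` (S \<inter> f -` T))"
        using f unfolding analytic_self_map_def by (rule conjunct2)
      from bspec[OF this S(1)]
      have "\<forall>(T, \<psi>)\<in>\<A>. real_analytic_on (\<psi> \<circ> f \<circ> inv_into S \<phi>) (\<phi> ` (S \<inter> f -` T))"
        by simp
      from bspec[OF this T(1)]
      have "real_analytic_on (\<psi> \<circ> f \<circ> inv_into S \<phi>) (\<phi> ` (S \<inter> f -` T))"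
        by simp
      then show ?thesis
        using S(2) T(2) unfolding real_analytic_on_def o_def by auto
    qed
    then have g: "extendable_at (\<lambda>y. complex_of_real (?g y $ i)) (\<phi> x)" for i
      by (rule real_analytic_at_imp_extendable_at[OF real_analytic_at_bounded_linear[OF _
            bounded_linear_compose[OF bounded_linear_of_real bounded_linear_vec_nth]]])
    have gx: "?g (\<phi> x) = \<psi> (f x)"
      using S S'(4) by simp
    have "extendable_at (\<lambda>y. h (inv_into T \<psi> y)) (?g (\<phi> x))"
      unfolding gx by (rule analytic_functionD(2)[OF h T])
    then have "extendable_at (\<lambda>y. h (inv_into T \<psi> (?g y))) (\<phi> x)"
      by (rule extendable_at_compose[OF g])
    moreover have "\<forall>\<^sub>F y in nhds (\<phi> x). h (inv_into T \<psi> (?g y)) = h (f (inv_into S \<phi> y))"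
    proof -
      have "isCont (inv_into S \<phi>) (\<phi> x)"
        using S'(2,5) S(2) by (simp add: continuous_on_eq_continuous_at)
      moreover have "isCont f (inv_into S \<phi> (\<phi> x))"
        using cf by (simp add: continuous_on_eq_continuous_at)
      ultimately have "isCont (\<lambda>y. f (inv_into S \<phi> y)) (\<phi> x)"
        by (rule isCont_o2)
      then have "\<forall>\<^sub>F y in nhds (\<phi> x). f (inv_into S \<phi> y) \<in> T"
        unfolding isCont_def
        using tendsto_at_iff_tendsto_nhds[of "\<lambda>y. f (inv_into S \<phi> y)" "\<phi> x"] T(2) S(2) S'(4)
        by (intro topological_tendstoD[OF _ T'(1)]) auto
      then show ?thesis
        by eventually_elim (simp add: T'(4))
    qed
    ultimately show ?thesis
      by (rule extendable_at_cong)
  qed (use S in simp)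
qed

lemma analytic_function_local_extension:
  fixes \<A> :: "('x::topological_space, 'l::finite) chart set"
  assumes h: "analytic_function \<A> h" and S: "(S, \<phi>) \<in> \<A>" "topological_chart (S, \<phi>)" "x \<in> S"
  obtains r H where "0 < r" "ball (\<phi> x) r \<subseteq> \<phi> ` S" "curve_holomorphic (ball (cvec (\<phi> x)) r) H"
    "\<And>z. z \<in> S \<Longrightarrow> \<phi> z \<in> ball (\<phi> x) r \<Longrightarrow> h z = H (cvec (\<phi> z))"
    "\<And>s. open (S \<inter> \<phi> -` ball (\<phi> x) s)"
proof -
  note ch = topological_chartD[OF S(2)]
  obtain r H where *: "0 < r" "curve_holomorphic (ball (cvec (\<phi> x)) r) H"
      "\<And>y. y \<in> ball (\<phi> x) r \<Longrightarrow> h (inv_into S \<phi> y) = H (cvec y)"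
    using analytic_functionD(2)[OF h S(1,3)] unfolding extendable_at_def by blast
  obtain s where s: "0 < s" "ball (\<phi> x) s \<subseteq> \<phi> ` S"
    using ch(2) S(3) open_contains_ball by blast
  show thesis
  proof (rule that[of "min r s" H])
    show "curve_holomorphic (ball (cvec (\<phi> x)) (min r s)) H"
      using *(2) by (rule curve_holomorphic_subset) auto
    show "h z = H (cvec (\<phi> z))" if "z \<in> S" "\<phi> z \<in> ball (\<phi> x) (min r s)" for z
      using *(3)[of "\<phi> z"] that ch(4) by simp
    show "open (S \<inter> \<phi> -` ball (\<phi> x) t)" for t
      by (rule continuous_open_preimage[OF ch(3,1) open_ball])
  qed (use * s in auto)
qed

text \<open>The identity theorem on the manifold: the interior of the zero set is closed, because in a ball of
  coordinates around one of its limit points the function vanishes near some point, hence everywhere.\<close>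

lemma analytic_function_nonzero_on_open:
  fixes \<A> :: "('x::topological_space, 'l::finite) chart set"
  assumes atlas: "real_analytic_atlas \<A>" and conn: "connected (UNIV :: 'x set)"
    and h: "analytic_function \<A> h" and x1: "h x1 \<noteq> 0" and W: "open W" "W \<noteq> {}"
  shows "\<exists>x\<in>W. h x \<noteq> 0"
proof (rule ccontr)
  assume zero: "\<not> ?thesis"
  define Z where "Z = interior {x. h x = 0}"
  have "W \<subseteq> Z"
    unfolding Z_def using zero W by (intro interior_maximal) auto
  have "closed Z"
    using atlas
  proof (cases rule: real_analytic_atlas_cases)
    case 1
    have "x \<in> Z" if xZ: "x \<in> closure Z" for x
    proof -
      obtain S \<phi> where S: "(S, \<phi>) \<in> \<A>" "topological_chart (S, \<phi>)" "x \<in> S"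
        using 1 by blast
      note ch = topological_chartD[OF S(2)]
      obtain r H where H: "0 < r" "ball (\<phi> x) r \<subseteq> \<phi> ` S" "curve_holomorphic (ball (cvec (\<phi> x)) r) H"
        "\<And>z. z \<in> S \<Longrightarrow> \<phi> z \<in> ball (\<phi> x) r \<Longrightarrow> h z = H (cvec (\<phi> z))"
        "\<And>s. open (S \<inter> \<phi> -` ball (\<phi> x) s)"
        using analytic_function_local_extension[OF h S] by blast
      let ?V = "S \<inter> \<phi> -` ball (\<phi> x) r"
      have "x \<in> ?V" using S(3) H(1) by simp
      then obtain z where z: "z \<in> ?V" "z \<in> Z"
        using xZ open_Int_closure_eq_empty[OF H(5)[of r], of Z] by blast
      have "\<forall>\<^sub>F y in nhds (\<phi> z). H (cvec y) = 0"
      proof -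
        have "open (\<phi> ` (Z \<inter> ?V))"
        proof -
          have "\<phi> ` (Z \<inter> ?V) = \<phi> ` S \<inter> inv_into S \<phi> -` (Z \<inter> ?V)"
            using ch(4) by (auto simp: image_iff)
          moreover have "open (\<phi> ` S \<inter> inv_into S \<phi> -` (Z \<inter> ?V))"
            by (rule continuous_open_preimage[OF ch(5,2)]) (use H(5) in \<open>auto simp: Z_def intro: open_Int\<close>)
          ultimately show ?thesis by simp
        qed
        moreover have "\<phi> z \<in> \<phi> ` (Z \<inter> ?V)"
          using z by blast
        moreover have "H (cvec y) = 0" if y: "y \<in> \<phi> ` (Z \<inter> ?V)" for y
        proof -
          obtain t where t: "t \<in> Z" "t \<in> ?V" "y = \<phi> t" using y by blast
          then have "h t = 0" using interior_subset unfolding Z_def by blast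
          then show ?thesis using H(4)[of t] t by simp
        qed
        ultimately show ?thesis
          unfolding eventually_nhds by blast
      qed
      then have "H (cvec y) = 0" if "y \<in> ball (\<phi> x) r" for y
        using curve_holomorphic_vanishing_spreads[OF H(3), of "\<phi> z"] z(1) that by simp
      then have "h t = 0" if "t \<in> ?V" for t
        using H(4)[of t] that by simp
      then have "?V \<subseteq> Z"
        unfolding Z_def using H(5) by (intro interior_maximal) auto
      then show ?thesis using \<open>x \<in> ?V\<close> by blast
    qed
    then show ?thesis
      by (meson closure_subset_eq subsetI)
  next
    case 2
    show ?thesis
      unfolding closed_def by (rule open_if_open_singletons[OF 2(2)])
  qed
  moreover have "open Z" by (simp add: Z_def)
  ultimately have "Z = {} \<or> Z = UNIV"
    using conn unfolding connected_clopen by (simp add: closedin_closed_eq open_openin[symmetric])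
  then have "Z = UNIV"
    using \<open>W \<subseteq> Z\<close> W by auto
  then show False
    using x1 interior_subset[of "{x. h x = 0}"] unfolding Z_def by blast
qed

lemma emeasure_chart_preimage_le:
  fixes \<phi> :: "'x::t2_space \<Rightarrow> real ^ 'l"
  assumes sets: "sets \<mu> = sets borel" and S: "topological_chart (S, \<phi>)"
    and D: "continuous_on (\<phi> ` S) D" "distr (restrict_space \<mu> S) (restrict_space borel (\<phi> ` S)) \<phi>
             = density (restrict_space lborel (\<phi> ` S)) (\<lambda>y. ennreal (D y))"
    and E: "E \<in> sets borel" "E \<subseteq> \<phi> ` S" and K: "\<And>y. y \<in> E \<Longrightarrow> D y \<le> K"
  shows "emeasure \<mu> (S \<inter> \<phi> -` E) \<le> ennreal K * emeasure lborel E"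
proof -
  note ch = topological_chartD[OF S]
  have space: "space \<mu> = UNIV"
    using sets_eq_imp_space_eq[OF sets] by simp
  have Sm: "S \<in> sets \<mu>"
    using ch(1) sets by simp
  have sr: "sets (restrict_space \<mu> S) = sets (restrict_space borel S)"
    by (rule sets_restrict_space_cong[OF sets])
  have "\<phi> \<in> measurable (restrict_space borel S) borel"
    by (rule borel_measurable_continuous_on_restrict[OF ch(3)])
  then have meas: "\<phi> \<in> measurable (restrict_space \<mu> S) (restrict_space borel (\<phi> ` S))"
    by (intro measurable_restrict_space2)
       (auto simp: space_restrict_space space measurable_cong_sets[OF sr refl])
  have Em: "E \<in> sets (restrict_space borel (\<phi> ` S))"
    using E ch(2) by (auto simp: sets_restrict_space_iff)
  have "emeasure \<mu> (S \<inter> \<phi> -` E) = emeasure (restrict_space \<mu> S) (\<phi> -` E \<inter> space (restrict_space \<mu> S))"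
    using Sm by (subst emeasure_restrict_space) (auto simp: space_restrict_space space Int_ac)
  also have "\<dots> = emeasure (distr (restrict_space \<mu> S) (restrict_space borel (\<phi> ` S)) \<phi>) E"
    by (rule emeasure_distr[OF meas Em, symmetric])
  also have "\<dots> = (\<integral>\<^sup>+y. ennreal (D y) * indicator E y \<partial>restrict_space lborel (\<phi> ` S))"
    unfolding D(2)
  proof (rule emeasure_density)
    have "D \<in> borel_measurable (restrict_space borel (\<phi> ` S))"
      by (rule borel_measurable_continuous_on_restrict[OF D(1)])
    then show "(\<lambda>y. ennreal (D y)) \<in> borel_measurable (restrict_space lborel (\<phi> ` S))"
      by (simp add: measurable_cong_sets[OF sets_restrict_space_cong[OF sets_lborel] refl])
    show "E \<in> sets (restrict_space lborel (\<phi> ` S))"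
      using Em by (simp add: sets_restrict_space_cong[OF sets_lborel])
  qed
  also have "\<dots> \<le> (\<integral>\<^sup>+y. ennreal K * indicator E y \<partial>restrict_space lborel (\<phi> ` S))"
    using K by (intro nn_integral_mono) (auto simp: indicator_def intro: ennreal_leI)
  also have "\<dots> = (\<integral>\<^sup>+y. ennreal K * indicator E y * indicator (\<phi> ` S) y \<partial>lborel)"
    using ch(2) by (subst nn_integral_restrict_space) auto
  also have "\<dots> \<le> (\<integral>\<^sup>+y. ennreal K * indicator E y \<partial>lborel)"
    by (intro nn_integral_mono) (auto simp: indicator_def)
  also have "\<dots> = ennreal K * emeasure lborel E"
    using E by (simp add: nn_integral_cmult_indicator)
  finally show ?thesis .
qed

text \<open>What analyticity contributes to the estimate of Lyapunov exponents: a nonzero analytic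
  function can approach 0 only at a power rate, so its logarithm is integrable. Every point has a
  neighbourhood over which this holds, by the sublevel estimate in a chart and the bounded density;
  compactness then leaves a finite sum.\<close>

lemma analytic_function_log_integrable:
  fixes \<A> :: "('x::t2_space, 'l::finite) chart set"
  assumes comp: "compact (UNIV :: 'x set)" and conn: "connected (UNIV :: 'x set)"
    and atlas: "real_analytic_atlas \<A>" and \<mu>: "prob_space \<mu>" "sets \<mu> = sets borel"
    and dens: "continuous_density_in_charts \<A> \<mu>"
    and h: "analytic_function \<A> h" and x1: "h x1 \<noteq> 0"
  shows "(\<integral>\<^sup>+x. neglog (cmod (h x)) \<partial>\<mu>) < \<infinity>"
proof -
  interpret prob_space \<mu> by fact
  have space: "space \<mu> = UNIV"
    using sets_eq_imp_space_eq[OF \<mu>(2)] by simp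
  have hm[measurable]: "(\<lambda>x. cmod (h x)) \<in> borel_measurable \<mu>"
    unfolding measurable_cong_sets[OF \<mu>(2) refl]
    by (intro borel_measurable_continuous_onI continuous_on_norm analytic_functionD(1)[OF h])
  have "\<exists>W. open W \<and> x \<in> W \<and> (\<integral>\<^sup>+z. neglog (cmod (h z)) * indicator W z \<partial>\<mu>) < \<infinity>" for x
    using atlas
  proof (cases rule: real_analytic_atlas_cases)
    case 1
    obtain S \<phi> where S: "(S, \<phi>) \<in> \<A>" "topological_chart (S, \<phi>)" "x \<in> S" and ac: "analytic_chart \<A> (S, \<phi>)"
      using 1 by blast
    obtain r H where H: "0 < r" "ball (\<phi> x) r \<subseteq> \<phi> ` S" "curve_holomorphic (ball (cvec (\<phi> x)) r) H"
      "\<And>z. z \<in> S \<Longrightarrow> \<phi> z \<in> ball (\<phi> x) r \<Longrightarrow> h z = H (cvec (\<phi> z))"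
      "\<And>s. open (S \<inter> \<phi> -` ball (\<phi> x) s)"
      using analytic_function_local_extension[OF h S] by blast
    have "S \<inter> \<phi> -` ball (\<phi> x) r \<noteq> {}"
      using S(3) H(1) by auto
    then obtain z where z: "z \<in> S \<inter> \<phi> -` ball (\<phi> x) r" "h z \<noteq> 0"
      using analytic_function_nonzero_on_open[OF atlas conn h x1 H(5)] by blast
    then have \<phi>z: "\<phi> z \<in> ball (\<phi> x) r" "H (cvec (\<phi> z)) \<noteq> 0"
      using H(4)[of z] by auto
    obtain \<rho> k c C where \<rho>: "0 < \<rho>" "\<rho> \<le> r" and c: "0 < c" "c \<le> 1" and C: "0 \<le> C" and
      sub: "\<And>\<eta>. 0 < \<eta> \<Longrightarrow> emeasure lborel {y \<in> ball (\<phi> x) \<rho>. cmod (H (cvec y)) < c * \<eta> ^ k} \<le> ennreal (C * \<eta>)"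
      by (rule curve_holomorphic_sublevel_estimate[OF H(3,1) \<phi>z]) (rule that)
    obtain D where D: "continuous_on (\<phi> ` S) D" "distr (restrict_space \<mu> S) (restrict_space borel (\<phi> ` S)) \<phi>
             = density (restrict_space lborel (\<phi> ` S)) (\<lambda>y. ennreal (D y))"
      using dens ac unfolding continuous_density_in_charts_def by blast
    \<comment> \<open>The density is bounded on a closed ball, hence the passage to half the radius.\<close>
    have sub_r: "cball (\<phi> x) (\<rho> / 2) \<subseteq> ball (\<phi> x) r"
      using \<rho> by auto
    have "compact (D ` cball (\<phi> x) (\<rho> / 2))"
      by (intro compact_continuous_image continuous_on_subset[OF D(1)]) (use sub_r H(2) in auto)
    then obtain K where K: "\<And>y. y \<in> cball (\<phi> x) (\<rho> / 2) \<Longrightarrow> D y \<le> K"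
      by (metis compact_imp_bounded bounded_imp_bdd_above bdd_above.E image_eqI)
    let ?W = "S \<inter> \<phi> -` ball (\<phi> x) (\<rho> / 2)"
    have "(\<integral>\<^sup>+z. neglog (cmod (h z)) * indicator ?W z \<partial>\<mu>) < \<infinity>"
    proof (rule nn_integral_neglog_finite[OF hm _ _ _ c])
      show "?W \<in> sets \<mu>"
        using H(5) \<mu>(2) by simp
      show "emeasure \<mu> ?W < \<infinity>"
        using emeasure_finite by (simp add: less_top[symmetric])
      fix \<eta> :: real assume \<eta>: "0 < \<eta>"
      let ?E = "{y \<in> ball (\<phi> x) (\<rho> / 2). cmod (H (cvec y)) < c * \<eta> ^ k}"
      have "continuous_on (ball (\<phi> x) (\<rho> / 2)) (\<lambda>y. cmod (H (cvec y)))"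
        by (intro continuous_on_norm continuous_on_compose2[OF curve_holomorphic_imp_continuous_on[OF H(3)] continuous_on_cvec])
           (use \<rho> in auto)
      from continuous_open_preimage[OF this open_ball open_lessThan, of "c * \<eta> ^ k"]
      have "open ?E" by (simp add: vimage_def Int_def conj_commute)
      have E_sub: "?E \<subseteq> \<phi> ` S"
        using order_trans[OF ball_subset_cball order_trans[OF sub_r H(2)]] by (rule subset_trans[rotated]) blast
      have "h z = H (cvec (\<phi> z))" if "z \<in> ?W" for z
        using that \<rho> by (intro H(4)) auto
      then have "{z \<in> ?W. cmod (h z) < c * \<eta> ^ k} = S \<inter> \<phi> -` ?E"
        by auto
      then have "emeasure \<mu> {z \<in> ?W. cmod (h z) < c * \<eta> ^ k} = emeasure \<mu> (S \<inter> \<phi> -` ?E)"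
        by simp
      also have "\<dots> \<le> ennreal K * emeasure lborel ?E"
        by (rule emeasure_chart_preimage_le[OF \<mu>(2) S(2) D])
           (use \<open>open ?E\<close> E_sub K in auto)
      also have "emeasure lborel ?E \<le> emeasure lborel {y \<in> ball (\<phi> x) \<rho>. cmod (H (cvec y)) < c * \<eta> ^ k}"
      proof (rule emeasure_mono)
        have "continuous_on (ball (\<phi> x) \<rho>) (\<lambda>y. cmod (H (cvec y)))"
          by (intro continuous_on_norm continuous_on_compose2[OF curve_holomorphic_imp_continuous_on[OF H(3)] continuous_on_cvec])
             (use \<rho> in auto)
        from continuous_open_preimage[OF this open_ball open_lessThan, of "c * \<eta> ^ k"]
        show "{y \<in> ball (\<phi> x) \<rho>. cmod (H (cvec y)) < c * \<eta> ^ k} \<in> sets lborel"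
          by (simp add: vimage_def Int_def conj_commute)
      qed (use \<rho> in auto)
      also have "\<dots> \<le> ennreal (C * \<eta>)"
        by (rule sub[OF \<eta>])
      finally have "emeasure \<mu> {z \<in> ?W. cmod (h z) < c * \<eta> ^ k} \<le> ennreal K * ennreal (C * \<eta>)"
        by (simp add: mult_left_mono)
      also have "\<dots> = ennreal (max 0 K * (C * \<eta>))"
        using C \<eta> by (subst ennreal_max_0[symmetric], subst ennreal_mult) (auto simp: ennreal_max_0)
      finally show "emeasure \<mu> {z \<in> ?W. cmod (h z) < c * \<eta> ^ k} \<le> ennreal (max 0 K * C * \<eta>)"
        by (simp add: mult_ac)
    qed auto
    moreover have "x \<in> ?W" using S(3) \<rho>(1) by simp
    ultimately show ?thesis
      using H(5) by blast
  next
    case 2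
    have "open T" for T :: "'x set"
      by (rule open_if_open_singletons[OF 2(2)])
    \<comment> \<open>A connected discrete space is a single point.\<close>
    then have "{x1} = {} \<or> {x1} = (UNIV :: 'x set)"
      using conn unfolding connected_clopen by (simp add: closedin_closed_eq open_openin[symmetric] closed_def) (metis insert_not_empty)
    then have "z = x1" for z by auto
    then have "(\<integral>\<^sup>+z. neglog (cmod (h z)) * indicator UNIV z \<partial>\<mu>) = (\<integral>\<^sup>+z. neglog (cmod (h x1)) \<partial>\<mu>)"
      by (intro nn_integral_cong) (metis indicator_UNIV mult.right_neutral)
    also have "\<dots> < \<infinity>"
      using x1 by (simp add: neglog_def emeasure_space_1)
    finally show ?thesis
      by (intro exI[of _ UNIV]) auto
  qed
  then obtain W where W: "\<And>x. open (W x)" "\<And>x. x \<in> W x"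
    "\<And>x. (\<integral>\<^sup>+z. neglog (cmod (h z)) * indicator (W x) z \<partial>\<mu>) < \<infinity>"
    by metis
  have "UNIV \<subseteq> (\<Union>x\<in>UNIV. W x)"
    using W(2) by blast
  then obtain F where F: "finite F" "UNIV \<subseteq> (\<Union>x\<in>F. W x)"
    using compactE_image[OF comp, of UNIV W] W(1) by metis
  have [measurable]: "W x \<in> sets \<mu>" for x
    using W(1) \<mu>(2) by simp
  have "(\<integral>\<^sup>+z. neglog (cmod (h z)) \<partial>\<mu>) \<le> (\<integral>\<^sup>+z. (\<Sum>x\<in>F. neglog (cmod (h z)) * indicator (W x) z) \<partial>\<mu>)"
  proof (rule nn_integral_mono)
    fix z
    obtain x where "x \<in> F" "z \<in> W x" using F(2) by blast
    then show "neglog (cmod (h z)) \<le> (\<Sum>x\<in>F. neglog (cmod (h z)) * indicator (W x) z)"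
      using F(1) member_le_sum[of x F "\<lambda>x. neglog (cmod (h z)) * indicator (W x) z"] by simp
  qed
  also have "\<dots> = (\<Sum>x\<in>F. \<integral>\<^sup>+z. neglog (cmod (h z)) * indicator (W x) z \<partial>\<mu>)"
    by (rule nn_integral_sum) measurable
  also have "\<dots> < \<infinity>"
    using W(3) F(1) by (simp add: less_top[symmetric])
  finally show ?thesis .
qed

section \<open>Lyapunov exponents of analytic cocycles\<close>

text \<open>Fekete's lemma in the case of a finite limit: division with remainder by an \<open>m\<close> with nearly minimal
  \<open>b m / m\<close> bounds \<open>b n / n\<close> from above.\<close>

lemma fekete_bounded_below:
  fixes b :: "nat \<Rightarrow> real"
  assumes sub: "\<And>m n. b (m + n) \<le> b m + b n" and lower: "\<And>n. 1 \<le> n \<Longrightarrow> - C * real n \<le> b n"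
  shows "convergent (\<lambda>n. b n / real n)"
proof -
  let ?L = "INF n\<in>{1..}. b n / real n"
  have bdd: "bdd_below ((\<lambda>n. b n / real n) ` {1..})"
  proof (rule bdd_belowI2)
    show "- C \<le> b n / real n" if "n \<in> {1..}" for n
      using that lower[of n] by (simp add: field_simps)
  qed
  have ge: "?L \<le> b n / real n" if "n \<ge> 1" for n
    using that by (intro cINF_lower[OF bdd]) auto
  have mult: "b (q * m) \<le> real q * b m" if "q \<ge> 1" for q m
    using that
  proof (induction q rule: nat_induct_at_least)
    case (Suc q)
    then show ?case
      using sub[of m "q * m"] by (simp add: algebra_simps)
  qed simp
  have "(\<lambda>n. b n / real n) \<longlonglongrightarrow> ?L"
  proof (rule LIMSEQ_I)
    fix e :: real assume e: "0 < e"
    obtain m where m: "m \<ge> 1" "b m / real m < ?L + e / 2"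
      using cINF_less_iff[OF _ bdd, of "?L + e / 2"] e by auto
    define K where "K = Max ((\<lambda>r. \<bar>b r\<bar>) ` {..<m}) + \<bar>b m\<bar>"
    have K: "\<bar>b r\<bar> + \<bar>b m\<bar> \<le> K" if "r < m" for r
      using that unfolding K_def by (intro add_right_mono Max_ge) auto
    have up: "b n \<le> real n * (b m / real m) + (K + \<bar>b m\<bar>)" if n: "n \<ge> m" for n
    proof -
      let ?q = "n div m" and ?r = "n mod m"
      have q: "?q \<ge> 1" and r: "?r < m"
        using n m by (auto simp: div_greater_zero_iff Suc_le_eq)
      have "b n \<le> b (?q * m) + b ?r"
        using sub[of "?q * m" ?r] by simp
      also have "\<dots> \<le> real ?q * b m + b ?r"
        using mult[OF q] by simp
      finally have le: "b n \<le> real ?q * b m + b ?r" .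
      have eq: "real ?q * b m = real n * (b m / real m) - real ?r * (b m / real m)"
      proof -
        have "real n = real ?q * real m + real ?r"
          by (metis div_mult_mod_eq of_nat_add of_nat_mult)
        then show ?thesis
          using m(1) by (simp add: field_simps)
      qed
      have "- (real ?r * (b m / real m)) \<le> \<bar>b m\<bar>"
      proof -
        have "\<bar>real ?r * (b m / real m)\<bar> = real ?r / real m * \<bar>b m\<bar>"
          by (simp add: abs_mult)
        also have "\<dots> \<le> 1 * \<bar>b m\<bar>"
          using r m(1) by (intro mult_right_mono) auto
        finally show ?thesis by linarith
      qed
      then show ?thesis
        using le eq K[OF r] by linarith
    qed
    obtain N where N: "real N > 2 * (K + \<bar>b m\<bar>) / e"
      using reals_Archimedean2 by blast
    show "\<exists>no. \<forall>n\<ge>no. norm (b n / real n - ?L) < e"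
    proof (intro exI allI impI)
      fix n assume n: "max m (max N 1) \<le> n"
      have "2 * (K + \<bar>b m\<bar>) / e < real n"
        using N n by simp
      then have small: "(K + \<bar>b m\<bar>) / real n < e / 2"
        using e n by (simp add: field_simps)
      have "b n / real n \<le> b m / real m + (K + \<bar>b m\<bar>) / real n"
        using up[of n] n by (simp add: field_simps)
      then have "b n / real n < ?L + e"
        using m(2) small by linarith
      then show "norm (b n / real n - ?L) < e"
        using ge[of n] n by simp
    qed
  qed
  then show ?thesis
    unfolding convergent_def by blast
qed

lemma cocycle_iter_add:
  "cocycle_iter f A (m + n) x = cocycle_iter f A m ((f ^^ n) x) ** cocycle_iter f A n x"
  by (induction m) (simp_all add: matrix_mul_assoc[symmetric] funpow_add)

lemma analytic_function_cocycle_iter: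
  fixes \<A> :: "('x::t2_space, 'l::finite) chart set"
  assumes "real_analytic_atlas \<A>" "analytic_self_map \<A> f" "analytic_vector_map \<A> A"
  shows "analytic_function \<A> (\<lambda>x. cocycle_iter f A n x $ i $ j)"
proof -
  have comp: "analytic_function \<A> (\<lambda>x. h ((f ^^ n) x))" if "analytic_function \<A> h" for h n
  proof (induction n)
    case (Suc n)
    then show ?case
      using analytic_function_compose_self_map[OF assms(1,2) Suc] by (simp add: funpow_Suc_right del: funpow.simps)
  qed (use that in simp)
  have A: "analytic_function \<A> (\<lambda>x. A x $ i $ j)" for i j
    by (rule analytic_vector_map_imp_analytic_function[OF assms(1,3)])
       (intro bounded_linear_compose[OF bounded_linear_vec_nth bounded_linear_vec_nth])
  show ?thesis
  proof (induction n arbitrary: i j)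
    case 0
    then show ?case by (simp add: analytic_function_const)
  next
    case (Suc n)
    then show ?case
      unfolding cocycle_iter.simps by (intro analytic_function_matrix_mult comp A)
  qed
qed

lemma ext_integral_ext_ln:
  fixes g :: "'a \<Rightarrow> real"
  assumes g[measurable]: "g \<in> borel_measurable M" and g0: "\<And>x. 0 \<le> g x"
    and fin: "(\<integral>\<^sup>+x. neglog (g x) \<partial>M) < \<infinity>" and bdd: "\<And>x. g x \<le> B" and M: "prob_space M"
  shows "integrable M (\<lambda>x. ln (g x))" "AE x in M. 0 < g x"
    and "ext_integral M (\<lambda>x. ext_ln (g x)) = ereal (\<integral>x. ln (g x) \<partial>M)"
    and "- enn2real (\<integral>\<^sup>+x. neglog (g x) \<partial>M) \<le> (\<integral>x. ln (g x) \<partial>M)"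
proof -
  interpret prob_space M by fact
  have "AE x in M. neglog (g x) \<noteq> \<infinity>"
    using fin by (intro nn_integral_PInf_AE) auto
  then show pos: "AE x in M. 0 < g x"
    by eventually_elim (auto simp: neglog_def split: if_splits)
  have neg: "(\<integral>\<^sup>+x. ennreal (- ln (g x)) \<partial>M) = (\<integral>\<^sup>+x. neglog (g x) \<partial>M)"
    by (rule nn_integral_cong_AE, use pos in eventually_elim) (auto simp: neglog_def)
  have posfin: "(\<integral>\<^sup>+x. ennreal (ln (g x)) \<partial>M) < \<infinity>"
  proof -
    have "(\<integral>\<^sup>+x. ennreal (ln (g x)) \<partial>M) \<le> (\<integral>\<^sup>+x. ennreal B \<partial>M)"
    proof (rule nn_integral_mono_AE)
      show "AE x in M. ennreal (ln (g x)) \<le> ennreal B"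
        using pos
      proof eventually_elim
        fix x assume "0 < g x"
        then have "ln (g x) \<le> B"
          using ln_le_minus_one[of "g x"] bdd[of x] by simp
        then show "ennreal (ln (g x)) \<le> ennreal B"
          by (rule ennreal_leI)
      qed
    qed
    also have "\<dots> < \<infinity>"
      by (simp add: emeasure_space_1)
    finally show ?thesis .
  qed
  show int: "integrable M (\<lambda>x. ln (g x))"
    unfolding real_integrable_def using posfin fin neg by (simp add: less_top)
  have P: "(\<integral>\<^sup>+x. e2ennreal (max 0 (ext_ln (g x))) \<partial>M) = (\<integral>\<^sup>+x. ennreal (ln (g x)) \<partial>M)"
    by (rule nn_integral_cong_AE, use pos in eventually_elim) (auto simp: ext_ln_def max_def ennreal.rep_eq e2ennreal_def ennreal_def zero_ereal_def)
  have N: "(\<integral>\<^sup>+x. e2ennreal (max 0 (- ext_ln (g x))) \<partial>M) = (\<integral>\<^sup>+x. ennreal (- ln (g x)) \<partial>M)"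
    by (rule nn_integral_cong_AE, use pos in eventually_elim) (auto simp: ext_ln_def max_def e2ennreal_def ennreal_def zero_ereal_def)
  have *: "(\<integral>x. ln (g x) \<partial>M) = enn2real (\<integral>\<^sup>+x. ennreal (ln (g x)) \<partial>M) - enn2real (\<integral>\<^sup>+x. ennreal (- ln (g x)) \<partial>M)"
    by (rule real_lebesgue_integral_def[OF int])
  show "- enn2real (\<integral>\<^sup>+x. neglog (g x) \<partial>M) \<le> (\<integral>x. ln (g x) \<partial>M)"
    unfolding * neg by simp
  have enn: "enn2ereal y = ereal (enn2real y)" if "y < \<infinity>" for y
    using that by (cases y) auto
  show "ext_integral M (\<lambda>x. ext_ln (g x)) = ereal (\<integral>x. ln (g x) \<partial>M)"
    unfolding ext_integral_def P N * using enn[OF posfin] enn[of "\<integral>\<^sup>+x. ennreal (- ln (g x)) \<partial>M"] neg fin by simp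
qed

lemma rank_le_max_rank: "rank (F x) \<le> max_rank F" for F :: "'x \<Rightarrow> complex ^ 'd ^ 'd"
proof -
  have "finite (range (\<lambda>x. rank (F x)))"
    by (rule finite_subset[of _ "{..CARD('d)}"]) (auto intro: rank_le_CARD)
  then show ?thesis
    unfolding max_rank_def by (intro Max_ge) auto
qed

lemma max_rank_attained:
  fixes F :: "'x \<Rightarrow> complex ^ 'd ^ 'd"
  obtains x where "rank (F x) = max_rank F"
proof -
  have "finite (range (\<lambda>x. rank (F x)))"
    by (rule finite_subset[of _ "{..CARD('d)}"]) (auto intro: rank_le_CARD)
  then have "max_rank F \<in> range (\<lambda>x. rank (F x))"
    unfolding max_rank_def by (intro Max_in) auto
  then show thesis
    using that by auto
qed

text \<open>Let \<open>s\<close> be the common maximal rank of the \<open>k\<close>-th and the next iterate, attained by the latter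
  at \<open>x0\<close>. The determinant \<open>m\<close> built from a generalized inverse at \<open>x0\<close> is an analytic function that
  is not identically zero, and \<open>A ((f ^^ k) x)\<close> scales norms by at least \<open>c * cmod (m x)\<close>
  on the range of the \<open>k\<close>-th iterate at \<open>x\<close>. For \<open>n > k\<close> the range of the \<open>n\<close>-th iterate lies in the range of
  the \<open>k\<close>-th iterate based at \<open>(f ^^ (n - k)) x\<close>. Hence the norm of the \<open>n\<close>-th iterate is at least a product
  of values of \<open>c * cmod m\<close> along the orbit times a fixed analytic function. The integrated
  logarithms are therefore bounded below by a linear function of \<open>n\<close>. They are also subadditive, so
  that the limit in the definition of the exponent exists and is a real number. The existence
  matters: \<open>lim\<close> has no specified value on a divergent sequence.\<close>

lemma lyapunov_exponent_finite_if_rank_stabilizes: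
  fixes \<A> :: "('x::{t2_space, second_countable_topology}, 'l::finite) chart set"
    and A :: "'x \<Rightarrow> complex ^ 'd ^ 'd"
  assumes cocycle: "analytic_cocycle \<A> \<mu> f A" and mp: "measure_preserving \<mu> f"
    and rk: "max_rank (cocycle_iter f A (Suc k)) = max_rank (cocycle_iter f A k)"
      "0 < max_rank (cocycle_iter f A k)"
  shows "lyapunov_exponent \<mu> f A 1 \<noteq> -\<infinity>"
proof -
  have comp: "compact (UNIV :: 'x set)" and conn: "connected (UNIV :: 'x set)" and atlas: "real_analytic_atlas \<A>"
    and \<mu>: "prob_space \<mu>" "sets \<mu> = sets borel" and dens: "continuous_density_in_charts \<A> \<mu>"
    and f: "analytic_self_map \<A> f" and A: "analytic_vector_map \<A> A"
    using cocycle unfolding analytic_cocycle_def by auto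
  interpret prob_space \<mu> by fact
  let ?A = "cocycle_iter f A"
  have fm[measurable]: "f \<in> measurable \<mu> \<mu>" and inv: "\<And>B. B \<in> sets \<mu> \<Longrightarrow> emeasure \<mu> (f -` B \<inter> space \<mu>) = emeasure \<mu> B"
    using mp unfolding measure_preserving_def by auto
  have fnm[measurable]: "(f ^^ n) \<in> measurable \<mu> \<mu>" for n
    by (induction n) (auto simp: o_def)
  have distr1: "distr \<mu> \<mu> f = \<mu>"
    by (rule measure_eqI) (auto simp: emeasure_distr inv)
  have distr: "distr \<mu> \<mu> (f ^^ n) = \<mu>" for n
  proof (induction n)
    case (Suc n)
    have "distr \<mu> \<mu> (f ^^ Suc n) = distr (distr \<mu> \<mu> (f ^^ n)) \<mu> f"
      by (subst distr_distr) auto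
    then show ?case by (simp only: Suc distr1)
  qed (simp add: distr_id2 id_def)
  have entries: "analytic_function \<A> (\<lambda>x. ?A n x $ i $ j)" for n i j
    by (rule analytic_function_cocycle_iter[OF atlas f A])
  have logint: "(\<integral>\<^sup>+x. neglog (cmod (h x)) \<partial>\<mu>) < \<infinity>" if "analytic_function \<A> h" "h x1 \<noteq> 0" for h x1
    by (rule analytic_function_log_integrable[OF comp conn atlas \<mu> dens that])
  have borel: "g \<in> borel_measurable \<mu>" if "continuous_on UNIV g" for g :: "'x \<Rightarrow> real"
    unfolding measurable_cong_sets[OF \<mu>(2) refl] using that by (rule borel_measurable_continuous_onI)
  define \<sigma> where "\<sigma> n x = opnorm (?A n x)" for n x
  have \<sigma>_cont: "continuous_on UNIV (\<sigma> n)" for n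
    unfolding \<sigma>_def by (rule continuous_on_opnorm) (rule analytic_functionD(1)[OF entries])
  have \<sigma>_meas[measurable]: "\<sigma> n \<in> borel_measurable \<mu>" for n
    by (rule borel[OF \<sigma>_cont])
  have \<sigma>_nonneg: "0 \<le> \<sigma> n x" for n x
    by (simp add: \<sigma>_def opnorm_nonneg)
  have bounded: "\<exists>B. \<forall>x. g x \<le> B" if "continuous_on UNIV g" for g :: "'x \<Rightarrow> real"
    using continuous_attains_sup[OF comp _ that] by auto
  obtain x0 where x0: "rank (?A (Suc k) x0) = max_rank (?A k)"
    using max_rank_attained[of "?A (Suc k)"] rk(1) by metis
  define Q where "Q = ?A (Suc k) x0"
  obtain E where E: "Q ** E ** Q = Q" "E ** Q ** E = E"
    by (rule reflexive_generalized_inverse)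
  define T where "T x = E ** (A ((f ^^ k) x) ** ?A k x) + (mat 1 - E ** Q)" for x
  define m where "m x = det (T x)" for x
  have T_entries: "analytic_function \<A> (\<lambda>x. T x $ i $ j)" for i j
    unfolding T_def vector_add_component using entries[of "Suc k"]
    by (intro analytic_function_add analytic_function_matrix_mult[of \<A> "\<lambda>_. E"] analytic_function_const) simp
  have m: "analytic_function \<A> m"
    unfolding m_def by (rule analytic_function_det[OF T_entries])
  have "T x0 = mat 1"
    unfolding T_def Q_def by simp
  then have m0: "m x0 \<noteq> 0"
    by (simp add: m_def)
  have "Q \<noteq> 0"
    using x0 rk(2) rank_pos[of Q] by (simp add: Q_def)
  then have "?A k x0 \<noteq> 0"
    unfolding Q_def by auto
  then obtain i j where ij: "?A k x0 $ i $ j \<noteq> 0"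
    by (auto simp: vec_eq_iff)
  define a where "a x = ?A k x $ i $ j" for x
  have a: "analytic_function \<A> a" "a x0 \<noteq> 0"
    unfolding a_def using ij entries by auto
  obtain K where K: "\<And>x. \<sigma> k x \<le> K" "\<And>x i j. cmod (T x $ i $ j) \<le> K"
  proof -
    have "continuous_on UNIV (\<lambda>x. \<Sum>i\<in>UNIV. \<Sum>j\<in>UNIV. cmod (T x $ i $ j))"
      by (intro continuous_on_sum continuous_on_norm analytic_functionD(1)[OF T_entries])
    from bounded[OF this] obtain B2 where B2: "\<And>x. (\<Sum>i\<in>UNIV. \<Sum>j\<in>UNIV. cmod (T x $ i $ j)) \<le> B2"
      by blast
    obtain B1 where B1: "\<And>x. \<sigma> k x \<le> B1"
      using bounded[OF \<sigma>_cont[of k]] by blast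
    have "cmod (T x $ i $ j) \<le> B2" for x i j
    proof -
      have "cmod (T x $ i $ j) \<le> (\<Sum>j\<in>UNIV. cmod (T x $ i $ j))"
        by (rule member_le_sum) auto
      also have "\<dots> \<le> (\<Sum>i\<in>UNIV. \<Sum>j\<in>UNIV. cmod (T x $ i $ j))"
        by (rule member_le_sum[of i UNIV "\<lambda>i. \<Sum>j\<in>UNIV. cmod (T x $ i $ j)"]) (auto intro: sum_nonneg)
      finally show ?thesis using B2[of x] by (rule order_trans)
    qed
    then show thesis
      using B1 by (intro that[of "max B1 B2"]) (auto simp: le_max_iff_disj)
  qed
  obtain c where c: "c > 0" and growth: "\<And>(B :: complex ^ 'd ^ 'd) P v. rank P \<le> rank Q \<Longrightarrow> opnorm P \<le> K \<Longrightarrow>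
       (\<forall>i j. cmod ((E ** (B ** P) + (mat 1 - E ** Q)) $ i $ j) \<le> K) \<Longrightarrow>
       c * cmod (det (E ** (B ** P) + (mat 1 - E ** Q))) * norm (P *v v) \<le> norm ((B ** P) *v v)"
    by (rule norm_ge_det_mult_norm[OF E(2,1), where K=K]) (rule that)
  have step: "c * cmod (m x) * norm (?A k x *v v) \<le> norm (?A (Suc k) x *v v)" for x v
    using growth[of "?A k x" "A ((f ^^ k) x)" v] rank_le_max_rank[of "?A k" x] x0 K[of x]
    by (simp add: m_def T_def Q_def \<sigma>_def)
  have iter: "(\<Prod>j<n. c * cmod (m ((f ^^ j) x))) * norm (?A k x *v v) \<le> norm (?A (n + k) x *v v)" for n x v
  proof (induction n)
    case (Suc n)
    let ?y = "(f ^^ n) x"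
    have "(\<Prod>j<Suc n. c * cmod (m ((f ^^ j) x))) * norm (?A k x *v v)
        = c * cmod (m ?y) * ((\<Prod>j<n. c * cmod (m ((f ^^ j) x))) * norm (?A k x *v v))"
      by (simp add: mult_ac)
    also have "\<dots> \<le> c * cmod (m ?y) * norm (?A (n + k) x *v v)"
      using c Suc by (intro mult_left_mono) auto
    also have "?A (n + k) x *v v = ?A k ?y *v (?A n x *v v)"
      by (subst add.commute) (simp add: cocycle_iter_add matrix_vector_mul_assoc)
    also have "c * cmod (m ?y) * norm \<dots> \<le> norm (?A (Suc k) ?y *v (?A n x *v v))"
      by (rule step)
    also have "?A (Suc k) ?y *v (?A n x *v v) = ?A (Suc k + n) x *v v"
      unfolding cocycle_iter_add by (simp add: matrix_vector_mul_assoc)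
    finally show ?case by (simp add: add.commute)
  qed simp
  have \<sigma>_lower: "(\<Prod>j<n. c * cmod (m ((f ^^ j) x))) * cmod (a x) \<le> \<sigma> (n + k) x" for n x
  proof -
    let ?v = "axis j (1::complex)"
    have "cmod (a x) = cmod ((?A k x *v ?v) $ i)"
      by (simp add: a_def matrix_vector_mult_def axis_def if_distrib cong: if_cong)
    also have "\<dots> \<le> norm (?A k x *v ?v)"
      by (rule Finite_Cartesian_Product.norm_nth_le)
    finally have "(\<Prod>j<n. c * cmod (m ((f ^^ j) x))) * cmod (a x) \<le> (\<Prod>j<n. c * cmod (m ((f ^^ j) x))) * norm (?A k x *v ?v)"
      using c by (intro mult_left_mono prod_nonneg) auto
    also have "\<dots> \<le> norm (?A (n + k) x *v ?v)"
      by (rule iter)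
    also have "\<dots> \<le> \<sigma> (n + k) x * norm ?v"
      unfolding \<sigma>_def by (rule opnorm_bound)
    finally show ?thesis by simp
  qed
  define I where "I = (\<integral>\<^sup>+x. neglog (c * cmod (m x)) \<partial>\<mu>)"
  define J where "J = (\<integral>\<^sup>+x. neglog (cmod (a x)) \<partial>\<mu>)"
  have m_meas[measurable]: "(\<lambda>x. cmod (m x)) \<in> borel_measurable \<mu>" and a_meas[measurable]: "(\<lambda>x. cmod (a x)) \<in> borel_measurable \<mu>"
    by (intro borel continuous_on_norm analytic_functionD(1)[OF m] analytic_functionD(1)[OF a(1)])+
  have I: "I < \<infinity>"
    using logint[OF analytic_function_mult[OF analytic_function_const[of _ "complex_of_real c"] m], of x0] m0 c
    by (simp add: I_def norm_mult)
  have J: "J < \<infinity>"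
    unfolding J_def by (rule logint[OF a])
  have I_shift: "(\<integral>\<^sup>+x. neglog (c * cmod (m ((f ^^ j) x))) \<partial>\<mu>) = I" for j
  proof -
    have "I = (\<integral>\<^sup>+x. neglog (c * cmod (m x)) \<partial>distr \<mu> \<mu> (f ^^ j))"
      by (simp add: I_def distr)
    also have "\<dots> = (\<integral>\<^sup>+x. neglog (c * cmod (m ((f ^^ j) x))) \<partial>\<mu>)"
      by (rule nn_integral_distr) measurable
    finally show ?thesis by simp
  qed
  have upper: "(\<integral>\<^sup>+x. neglog (\<sigma> (n + k) x) \<partial>\<mu>) \<le> of_nat n * I + J" for n
  proof -
    have "(\<integral>\<^sup>+x. neglog (\<sigma> (n + k) x) \<partial>\<mu>) \<le>
        (\<integral>\<^sup>+x. (\<Sum>j<n. neglog (c * cmod (m ((f ^^ j) x)))) + neglog (cmod (a x)) \<partial>\<mu>)"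
    proof (rule nn_integral_mono)
      fix x
      have "neglog (\<sigma> (n + k) x) \<le> neglog ((\<Prod>j<n. c * cmod (m ((f ^^ j) x))) * cmod (a x))"
        by (rule neglog_antimono[OF \<sigma>_lower])
      also have "\<dots> \<le> neglog (\<Prod>j<n. c * cmod (m ((f ^^ j) x))) + neglog (cmod (a x))"
        using c by (intro neglog_mult_le prod_nonneg) auto
      also have "neglog (\<Prod>j<n. c * cmod (m ((f ^^ j) x))) \<le> (\<Sum>j<n. neglog (c * cmod (m ((f ^^ j) x))))"
        using c by (intro neglog_prod_le) auto
      finally show "neglog (\<sigma> (n + k) x) \<le> (\<Sum>j<n. neglog (c * cmod (m ((f ^^ j) x)))) + neglog (cmod (a x))"
        by (simp add: add_right_mono)
    qed
    also have "\<dots> = (\<Sum>j<n. \<integral>\<^sup>+x. neglog (c * cmod (m ((f ^^ j) x))) \<partial>\<mu>) + J"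
      unfolding J_def by (subst nn_integral_add) (auto simp: nn_integral_sum measurable_compose[OF fnm m_meas])
    also have "\<dots> = of_nat n * I + J"
      by (simp add: I_shift)
    finally show ?thesis .
  qed
  define b where "b n = (\<integral>x. ln (\<sigma> n x) \<partial>\<mu>)" for n
  have \<sigma>_sub: "\<sigma> (p + n) x \<le> \<sigma> p ((f ^^ n) x) * \<sigma> n x" for p n x
    unfolding \<sigma>_def cocycle_iter_add by (rule opnorm_mult_le)
  obtain B where B: "\<And>x. \<sigma> k x \<le> B" using bounded[OF \<sigma>_cont] by blast
  \<comment> \<open>Iterates of order less than \<open>k\<close> are bounded below through later ones, since
    \<open>\<sigma> (n + k) \<le> B' * \<sigma> n\<close>.\<close>
  define B' where "B' = max B 1"
  have upper': "(\<integral>\<^sup>+x. neglog (\<sigma> n x) \<partial>\<mu>) \<le> neglog (1 / B') + (of_nat n * I + J)" for n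
  proof -
    have "neglog (\<sigma> n x) \<le> neglog (1 / B') + neglog (\<sigma> (n + k) x)" for x
    proof -
      have "\<sigma> (n + k) x \<le> \<sigma> k ((f ^^ n) x) * \<sigma> n x"
        using \<sigma>_sub[of k n x] by (simp add: add.commute)
      also have "\<dots> \<le> B' * \<sigma> n x"
        using B[of "(f ^^ n) x"] by (intro mult_right_mono \<sigma>_nonneg) (simp add: B'_def)
      finally have "1 / B' * \<sigma> (n + k) x \<le> \<sigma> n x"
        by (simp add: B'_def field_simps)
      then have "neglog (\<sigma> n x) \<le> neglog (1 / B' * \<sigma> (n + k) x)"
        by (rule neglog_antimono)
      also have "\<dots> \<le> neglog (1 / B') + neglog (\<sigma> (n + k) x)"
        by (intro neglog_mult_le \<sigma>_nonneg) (simp add: B'_def)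
      finally show ?thesis .
    qed
    then have "(\<integral>\<^sup>+x. neglog (\<sigma> n x) \<partial>\<mu>) \<le> (\<integral>\<^sup>+x. neglog (1 / B') + neglog (\<sigma> (n + k) x) \<partial>\<mu>)"
      by (intro nn_integral_mono)
    also have "\<dots> = neglog (1 / B') + (\<integral>\<^sup>+x. neglog (\<sigma> (n + k) x) \<partial>\<mu>)"
      by (subst nn_integral_add) (auto simp: emeasure_space_1)
    also have "\<dots> \<le> neglog (1 / B') + (of_nat n * I + J)"
      by (intro add_left_mono upper)
    finally show ?thesis .
  qed
  obtain I' where I': "I = ennreal I'" "0 \<le> I'"
    using I by (cases I) auto
  obtain J' where J': "J = ennreal J'" "0 \<le> J'"
    using J by (cases J) auto
  define L where "L = ln B'"
  have L: "neglog (1 / B') = ennreal L" "0 \<le> L"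
    by (auto simp: L_def neglog_def B'_def ln_div)
  have upper_real: "(\<integral>\<^sup>+x. neglog (\<sigma> n x) \<partial>\<mu>) \<le> ennreal (L + (real n * I' + J'))" for n
    using upper'[of n] L I' J' by (simp add: ennreal_of_nat_eq_real_of_nat ennreal_mult[symmetric] ennreal_plus[symmetric] del: ennreal_plus)
  have fin: "(\<integral>\<^sup>+x. neglog (\<sigma> n x) \<partial>\<mu>) < \<infinity>" for n
    by (rule le_less_trans[OF upper_real]) simp
  have \<sigma>_int: "integrable \<mu> (\<lambda>x. ln (\<sigma> n x))" "AE x in \<mu>. 0 < \<sigma> n x"
    "ext_integral \<mu> (\<lambda>x. ext_ln (\<sigma> n x)) = ereal (b n)"
    "- enn2real (\<integral>\<^sup>+x. neglog (\<sigma> n x) \<partial>\<mu>) \<le> b n" for n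
  proof -
    obtain B where B: "\<And>x. \<sigma> n x \<le> B" using bounded[OF \<sigma>_cont] by blast
    note ext_integral_ext_ln[OF \<sigma>_meas \<sigma>_nonneg fin B \<mu>(1)]
    then show "integrable \<mu> (\<lambda>x. ln (\<sigma> n x))" "AE x in \<mu>. 0 < \<sigma> n x"
      "ext_integral \<mu> (\<lambda>x. ext_ln (\<sigma> n x)) = ereal (b n)"
      "- enn2real (\<integral>\<^sup>+x. neglog (\<sigma> n x) \<partial>\<mu>) \<le> b n"
      unfolding b_def by auto
  qed
  have "convergent (\<lambda>n. b n / real n)"
  proof (rule fekete_bounded_below)
    show "b (p + n) \<le> b p + b n" for p n
    proof -
      have int_shift: "integrable \<mu> (\<lambda>x. ln (\<sigma> p ((f ^^ n) x)))"
        using integrable_distr[OF fnm[of n], of "\<lambda>x. ln (\<sigma> p x)"] \<sigma>_int(1)[of p] by (simp add: distr)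
      have "b (p + n) \<le> (\<integral>x. ln (\<sigma> p ((f ^^ n) x)) + ln (\<sigma> n x) \<partial>\<mu>)"
        unfolding b_def
      proof (rule integral_mono_AE)
        show "AE x in \<mu>. ln (\<sigma> (p + n) x) \<le> ln (\<sigma> p ((f ^^ n) x)) + ln (\<sigma> n x)"
          using \<sigma>_int(2)[of "p + n"]
        proof eventually_elim
          fix x assume pos: "0 < \<sigma> (p + n) x"
          then have "0 < \<sigma> p ((f ^^ n) x) * \<sigma> n x"
            using \<sigma>_sub[of p n x] by simp
          then have "0 < \<sigma> p ((f ^^ n) x)" "0 < \<sigma> n x"
            using \<sigma>_nonneg[of p "(f ^^ n) x"] \<sigma>_nonneg[of n x] by (auto simp: zero_less_mult_iff)
          then show "ln (\<sigma> (p + n) x) \<le> ln (\<sigma> p ((f ^^ n) x)) + ln (\<sigma> n x)"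
            using pos \<sigma>_sub[of p n x] ln_mult_pos ln_mono by metis
        qed
      qed (use \<sigma>_int(1) int_shift in auto)
      also have "\<dots> = (\<integral>x. ln (\<sigma> p ((f ^^ n) x)) \<partial>\<mu>) + b n"
        unfolding b_def by (rule Bochner_Integration.integral_add[OF int_shift \<sigma>_int(1)])
      also have "(\<integral>x. ln (\<sigma> p ((f ^^ n) x)) \<partial>\<mu>) = b p"
        using integral_distr[OF fnm[of n], of "\<lambda>x. ln (\<sigma> p x)"] by (simp add: distr b_def)
      finally show ?thesis .
    qed
    show "- (L + I' + J') * real n \<le> b n" if "1 \<le> n" for n
    proof -
      have "enn2real (\<integral>\<^sup>+x. neglog (\<sigma> n x) \<partial>\<mu>) \<le> L + (real n * I' + J')"
        using upper_real[of n] L I' J' by (intro enn2real_leI) auto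
      moreover have "L \<le> L * real n" "J' \<le> J' * real n"
        using that L J' by (auto simp: mult_le_cancel_left1)
      ultimately show ?thesis
        using \<sigma>_int(4)[of n] by (simp add: algebra_simps)
    qed
  qed
  then obtain l where l: "(\<lambda>n. b n / real n) \<longlonglongrightarrow> l"
    unfolding convergent_def by blast
  have "(\<lambda>n. ext_integral \<mu> (\<lambda>x. ext_ln (singular_value 1 (?A n x))) / ereal (real n)) \<longlonglongrightarrow> ereal l"
  proof (rule Lim_transform_eventually)
    show "(\<lambda>n. ereal (b n / real n)) \<longlonglongrightarrow> ereal l"
      using l by simp
    show "\<forall>\<^sub>F n in sequentially. ereal (b n / real n) =
        ext_integral \<mu> (\<lambda>x. ext_ln (singular_value 1 (?A n x))) / ereal (real n)"
      using eventually_gt_at_top[of 0]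
      unfolding singular_value_1 \<sigma>_def[symmetric] \<sigma>_int(3) by eventually_elim simp
  qed
  then have "lyapunov_exponent \<mu> f A 1 = ereal l"
    unfolding lyapunov_exponent_def by (rule limI)
  then show ?thesis
    by simp
qed

theorem theorem1:
  fixes \<A> :: "('x::{t2_space, second_countable_topology}, 'l::finite) chart set"
    and \<mu> :: "'x measure"
    and f :: "'x \<Rightarrow> 'x"
    and A :: "'x \<Rightarrow> complex ^ 'd ^ 'd"
  assumes "analytic_cocycle \<A> \<mu> f A"
    and "measure_preserving \<mu> f"
    and "lyapunov_exponent \<mu> f A 1 = -\<infinity>"
  shows "nilpotent_cocycle \<mu> f A \<and>
         max_rank A \<le> CARD('d) - 1 \<and>
         (\<forall>x. cocycle_iter f A (max_rank A + 1) x = 0)"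
proof -
  let ?R = "\<lambda>n. max_rank (cocycle_iter f A n)"
  have mono: "?R (Suc n) \<le> ?R n" for n
  proof -
    obtain x where "rank (cocycle_iter f A (Suc n) x) = ?R (Suc n)"
      by (rule max_rank_attained)
    then have "?R (Suc n) \<le> rank (cocycle_iter f A n x)"
      by (metis cocycle_iter.simps(2) rank_mult_le_right)
    also have "\<dots> \<le> ?R n"
      by (rule rank_le_max_rank)
    finally show ?thesis .
  qed
  have decr: "?R (Suc n) < ?R n" if "0 < ?R n" for n
    using lyapunov_exponent_finite_if_rank_stabilizes[OF assms(1,2) _ that] mono[of n] assms(3) by force
  obtain x0 :: 'x where "rank (cocycle_iter f A 0 x0) = ?R 0"
    by (rule max_rank_attained)
  then have R0: "?R 0 = CARD('d)"
    by (simp add: rank_mat_1)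
  have "cocycle_iter f A (Suc 0) = A"
    by (simp add: fun_eq_iff)
  then have R1: "?R (Suc 0) = max_rank A"
    by simp
  have *: "?R (Suc n) \<le> max_rank A - n" for n
  proof (induction n)
    case (Suc n)
    then show ?case
      using decr[of "Suc n"] mono[of "Suc n"]
      by (cases "?R (Suc n) = 0") (auto simp del: cocycle_iter.simps)
  qed (simp add: R1)
  have "?R (max_rank A + 1) = 0"
    using *[of "max_rank A"] by simp
  then have zero: "cocycle_iter f A (max_rank A + 1) x = 0" for x
    using rank_le_max_rank[of "cocycle_iter f A (max_rank A + 1)" x] rank_pos[of "cocycle_iter f A (max_rank A + 1) x"]
    by (metis gr_zeroI le_zero_eq not_less_zero)
  then have "nilpotent_cocycle \<mu> f A"
    unfolding nilpotent_cocycle_def by (intro exI[of _ "max_rank A + 1"]) auto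
  moreover have "max_rank A \<le> CARD('d) - 1"
    using decr[of 0] R0 R1 by simp
  ultimately show ?thesis
    using zero by blast
qed

end
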